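(* Let $n\geq 12$ and $1\leq \ell\leq \lfloor\frac{n+1}{2}\rfloor$ be integers. Then $$ g(n;\overline{\lambda}_{n-1}\leq \ell)=\begin{cases} \binom{n-2}{2}+2\ell, & \text{if } 1\leq \ell\leq \lfloor\frac{n-5}{2}\rfloor, \text{ or } \ell=\lfloor\frac{n-3}{2}\rfloor \text{ and } n \text{ is even};\\ \binom{n-2}{2}+2\ell+1, & \text{if } \ell=\lfloor\frac{n-3}{2}\rfloor \text{ and } n \text{ is odd};\\ \binom{n-1}{2}+\ell, & \text{if } \ell=\lfloor\frac{n-1}{2}\rfloor \text{ and } n \text{ is even};\\ \binom{n-1}{2}+2\ell-1, & \text{if } \ell=\lfloor\frac{n-1}{2}\rfloor \text{ and } n \text{ is odd};\\ \binom{n}{2}, & \text{if } \ell=\lfloor\frac{n+1}{2}\rfloor. \end{cases} $$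
   Context: All graphs are finite, simple and undirected; $e(G)$ is the number of edges of $G$. For a graph $G$ and $S\subseteq V(G)$ with $|S|\geq 2$, a tree connecting $S$ is a subgraph of $G$ that is a tree whose vertex set contains $S$. Let $\lambda(S)$ be the maximum number of pairwise edge-disjoint trees connecting $S$ in $G$. For $2\leq k\leq |V(G)|$, $\overline{\lambda}_k(G)=\max\{\lambda(S): S\subseteq V(G),\ |S|=k\}$. Define $g(n;\overline{\lambda}_k\leq \ell)=\max\{e(G): |V(G)|=n,\ \overline{\lambda}_k(G)\leq \ell\}$. *)

theory Defs
  imports Main
begin

text \<open>
  A graph is a pair of a vertex set and a set of edges, an edge being a two-element set of
  vertices.
\<close>

type_synonym 'a ugraph = "'a set \<times> 'a set set"

abbreviation vset :: "'a ugraph \<Rightarrow> 'a set" where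
  "vset \<equiv> fst"

abbreviation eset :: "'a ugraph \<Rightarrow> 'a set set" where
  "eset \<equiv> snd"

definition simple_ugraph :: "'a ugraph \<Rightarrow> bool" where
  "simple_ugraph G \<longleftrightarrow> finite (vset G) \<and> (\<forall>e\<in>eset G. e \<subseteq> vset G \<and> card e = 2)"

definition sub_ugraph :: "'a ugraph \<Rightarrow> 'a ugraph \<Rightarrow> bool" where
  "sub_ugraph H G \<longleftrightarrow> simple_ugraph H \<and> vset H \<subseteq> vset G \<and> eset H \<subseteq> eset G"

definition walk_in :: "'a ugraph \<Rightarrow> 'a list \<Rightarrow> bool" where
  "walk_in G p \<longleftrightarrow>
     p \<noteq> [] \<and> set p \<subseteq> vset G \<and> successively (\<lambda>u v. {u, v} \<in> eset G) p"

definition connected_ugraph :: "'a ugraph \<Rightarrow> bool" where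
  "connected_ugraph G \<longleftrightarrow>
     vset G \<noteq> {} \<and> (\<forall>u\<in>vset G. \<forall>v\<in>vset G. \<exists>p. walk_in G p \<and> hd p = u \<and> last p = v)"

text \<open>A cycle is listed without repeating its first vertex at the end.\<close>

definition cycle_in :: "'a ugraph \<Rightarrow> 'a list \<Rightarrow> bool" where
  "cycle_in G p \<longleftrightarrow>
     3 \<le> length p \<and> distinct p \<and> walk_in G p \<and> {last p, hd p} \<in> eset G"

definition tree_ugraph :: "'a ugraph \<Rightarrow> bool" where
  "tree_ugraph T \<longleftrightarrow> simple_ugraph T \<and> connected_ugraph T \<and> (\<nexists>p. cycle_in T p)"

definition tree_connecting :: "'a ugraph \<Rightarrow> 'a set \<Rightarrow> 'a ugraph \<Rightarrow> bool" where
  "tree_connecting G S T \<longleftrightarrow> sub_ugraph T G \<and> tree_ugraph T \<and> S \<subseteq> vset T"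

definition edge_disjoint_trees :: "'a ugraph \<Rightarrow> 'a set \<Rightarrow> 'a ugraph set \<Rightarrow> bool" where
  "edge_disjoint_trees G S \<T> \<longleftrightarrow>
     (\<forall>T\<in>\<T>. tree_connecting G S T) \<and>
     pairwise (\<lambda>T T'. eset T \<inter> eset T' = {}) \<T>"

text \<open>
  The quantity \<open>\<lambda>(S)\<close>, meaningful for \<open>S \<subseteq> vset G\<close> with \<open>card S \<ge> 2\<close>. A tree connecting
  such an \<open>S\<close> has an edge, so edge-disjoint trees are distinct and it makes no difference that
  a set of trees is counted here rather than an indexed family.
\<close>

definition tree_conn :: "'a ugraph \<Rightarrow> 'a set \<Rightarrow> nat" where
  "tree_conn G S = Max {card \<T> | \<T>. edge_disjoint_trees G S \<T>}"

text \<open>The quantity \<open>\<lambda>\<close>-bar, meaningful for \<open>2 \<le> k \<le> card (vset G)\<close>.\<close>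

definition max_tree_conn :: "nat \<Rightarrow> 'a ugraph \<Rightarrow> nat" where
  "max_tree_conn k G = Max {tree_conn G S | S. S \<subseteq> vset G \<and> card S = k}"

text \<open>
  The extremal number. Every finite graph is isomorphic to one whose vertices are natural
  numbers, so the vertex type is fixed to \<^typ>\<open>nat\<close>. There are infinitely many such
  graphs of order \<open>n\<close>, but only finitely many values of the number of edges.
\<close>

definition extremal_edges :: "nat \<Rightarrow> nat \<Rightarrow> nat \<Rightarrow> nat" where
  "extremal_edges n k l =
     Max {card (eset G) | G :: nat ugraph.
            simple_ugraph G \<and> card (vset G) = n \<and> max_tree_conn k G \<le> l}"

end

theory Submission
  imports Defs
begin

text \<open>
  A graph is described by the set \<open>M\<close> of its missing edges. To pack trees into the complement of
  \<open>M\<close>, delete two vertices \<open>a\<close> and \<open>b\<close>, pack one tree less into the rest, attach \<open>a\<close> and \<open>b\<close> to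
  these trees as leaves, and build one further tree from a double star with centres \<open>a\<close> and \<open>b\<close>. The
  vertices that the double star cannot reach are attached to it by edges taken from the rest, which
  thereby become missing there. If \<open>a\<close> has maximum and \<open>b\<close> minimum degree in \<open>M\<close>, then the bounds on
  the size and the maximum degree of \<open>M\<close> are preserved. This replaces the tree packing theorem of
  Nash-Williams and Tutte. A vertex \<open>v\<close> outside of \<open>S\<close> is used by at most one tree, which contains
  all edges at \<open>v\<close>, except when \<open>M\<close> consists of two stars.

  Conversely, \<open>t\<close> edge-disjoint trees connecting \<open>S = V - {v}\<close> have at least \<open>t (n - 2)\<close> edges,
  with equality only if none of them contains \<open>v\<close>.
\<close>

section \<open>Degrees in a set of pairs\<close>

text \<open>Two obstructions produce the values. Two vertices of degree \<open>l\<close> rule out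
  \<open>l + 1\<close> trees, as one of them lies in \<open>S\<close>; this permits
  \<open>(n - 2 choose 2) + 2 * l\<close> edges. Counting permits \<open>(l + 1) * (n - 2)\<close>
  edges if every vertex lies on an edge, since \<open>l + 1\<close> trees would have to use up all
  edges and avoid \<open>v\<close>. The first value is larger when \<open>2 * l + 4 \<le> n\<close>,
  the second when \<open>n\<close> is \<open>2 * l + 3\<close>, \<open>2 * l + 2\<close> or
  \<open>2 * l + 1\<close>; for \<open>n \<le> 2 * l\<close> even the complete graph has fewer than
  \<open>(l + 1) * (n - 2)\<close> edges.

  A graph with more edges than the first value has at most \<open>2 * r\<close> missing edges, where
  \<open>r = n - 2 - l\<close>. Spanning trees can fail at exactly \<open>2 * r\<close>: if the
  missing edges form stars of size \<open>r\<close> at two vertices that the graph joins, then both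
  centres keep only \<open>l + 1\<close> edges, so both would be leaves of each of
  \<open>l + 1\<close> spanning trees, and the tree with the edge between them could reach nothing
  else. Leaving one centre out of \<open>S\<close> removes this obstacle.\<close>

definition pairs :: "'a set \<Rightarrow> 'a set set" where
  "pairs V = {e. e \<subseteq> V \<and> card e = 2}"

definition deg :: "'a set set \<Rightarrow> 'a \<Rightarrow> nat" where
  "deg M x = card {e \<in> M. x \<in> e}"

definition star :: "'a \<Rightarrow> 'a set \<Rightarrow> 'a set set" where
  "star a X = (\<lambda>x. {a, x}) ` X"

lemma doubleton_in_pairs: "{x, y} \<in> pairs V \<longleftrightarrow> x \<in> V \<and> y \<in> V \<and> x \<noteq> y"
  by (auto simp: pairs_def card_insert_if)

lemma pairsE:
  assumes "e \<in> pairs V"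
  obtains x y where "e = {x, y}" "x \<in> V" "y \<in> V" "x \<noteq> y"
  using assms by (auto simp: pairs_def card_2_iff)

lemma pairs_other:
  assumes "e \<in> pairs V" "x \<in> e"
  obtains y where "e = {x, y}" "x \<in> V" "y \<in> V" "x \<noteq> y"
  using assms by (elim pairsE) auto

lemma pairs_mono: "U \<subseteq> V \<Longrightarrow> pairs U \<subseteq> pairs V"
  by (auto simp: pairs_def)

lemma finite_pairs: "finite V \<Longrightarrow> finite (pairs V)"
  by (auto simp: pairs_def)

lemma card_pairs: "finite V \<Longrightarrow> card (pairs V) = card V choose 2"
  by (simp add: pairs_def n_subsets)

lemma finite_missing: "finite V \<Longrightarrow> M \<subseteq> pairs V \<Longrightarrow> finite M"
  using finite_pairs finite_subset by blast

lemma deg_eq_card_nbrs: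
  assumes "M \<subseteq> pairs V"
  shows "deg M x = card {y \<in> V. {x, y} \<in> M}"
proof -
  have "{e \<in> M. x \<in> e} = (\<lambda>y. {x, y}) ` {y \<in> V. {x, y} \<in> M}"
  proof (intro equalityI subsetI)
    fix e assume "e \<in> {e \<in> M. x \<in> e}"
    then have "e \<in> M" "e \<in> pairs V" "x \<in> e"
      using assms by auto
    then show "e \<in> (\<lambda>y. {x, y}) ` {y \<in> V. {x, y} \<in> M}"
      by (elim pairs_other) auto
  qed auto
  moreover have "inj_on (\<lambda>y. {x, y}) {y \<in> V. {x, y} \<in> M}"
    by (auto simp: inj_on_def doubleton_eq_iff)
  ultimately show ?thesis
    by (simp add: deg_def card_image)
qed

lemma card_non_nbrs:
  assumes "finite V" "M \<subseteq> pairs V" "v \<in> V"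
  shows "card {x \<in> V - {v}. {v, x} \<notin> M} + deg M v + 1 = card V"
proof -
  have v: "{v, v} \<notin> M"
    using assms by (auto simp: pairs_def)
  have "V = insert v ({x \<in> V - {v}. {v, x} \<notin> M} \<union> {y \<in> V. {v, y} \<in> M})"
    using assms by auto
  then have "card V = card (insert v ({x \<in> V - {v}. {v, x} \<notin> M} \<union> {y \<in> V. {v, y} \<in> M}))"
    by simp
  also have "\<dots> = Suc (card ({x \<in> V - {v}. {v, x} \<notin> M} \<union> {y \<in> V. {v, y} \<in> M}))"
    using assms v by (subst card_insert_disjoint) auto
  also have "card ({x \<in> V - {v}. {v, x} \<notin> M} \<union> {y \<in> V. {v, y} \<in> M})
      = card {x \<in> V - {v}. {v, x} \<notin> M} + card {y \<in> V. {v, y} \<in> M}"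
    using assms by (subst card_Un_disjoint) auto
  finally show ?thesis
    using deg_eq_card_nbrs[OF assms(2)] by simp
qed

lemma deg_mono: "finite N \<Longrightarrow> M \<subseteq> N \<Longrightarrow> deg M x \<le> deg N x"
  unfolding deg_def by (rule card_mono) auto

lemma deg_le_card: "finite M \<Longrightarrow> deg M x \<le> card M"
  unfolding deg_def by (rule card_mono) auto

lemma deg_pos_iff: "finite M \<Longrightarrow> 0 < deg M x \<longleftrightarrow> (\<exists>e\<in>M. x \<in> e)"
  by (auto simp: deg_def card_gt_0_iff)

lemma card_restrict:
  assumes "finite V" "M \<subseteq> pairs V"
  shows "card (M \<inter> Pow (V - {a})) + deg M a = card M"
proof -
  have fin: "finite M"
    using assms by (rule finite_missing)
  have "M = (M \<inter> Pow (V - {a})) \<union> {e \<in> M. a \<in> e}"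
    using assms(2) by (auto simp: pairs_def)
  moreover have "card ((M \<inter> Pow (V - {a})) \<union> {e \<in> M. a \<in> e})
      = card (M \<inter> Pow (V - {a})) + card {e \<in> M. a \<in> e}"
    using fin by (intro card_Un_disjoint) auto
  ultimately show ?thesis
    by (simp add: deg_def)
qed

lemma deg_restrict:
  assumes "finite V" "M \<subseteq> pairs V" "a \<noteq> b"
  shows "deg (M \<inter> Pow (V - {a})) b + (if {a, b} \<in> M then 1 else 0) = deg M b"
proof -
  have fin: "finite M"
    using assms(1,2) by (rule finite_missing)
  have *: "{e \<in> M. b \<in> e \<and> a \<in> e} = (if {a, b} \<in> M then {{a, b}} else {})"
  proof -
    have "e = {a, b}" if e: "e \<in> M" "b \<in> e" "a \<in> e" for e
    proof -
      have "e \<in> pairs V"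
        using e(1) assms(2) by blast
      then obtain y where "e = {b, y}"
        using e(2) by (rule pairs_other)
      then show ?thesis
        using e(3) assms(3) by auto
    qed
    then have "{e \<in> M. b \<in> e \<and> a \<in> e} = {e \<in> M. e = {a, b}}"
      by (intro Collect_cong) blast
    also have "\<dots> = (if {a, b} \<in> M then {{a, b}} else {})"
      by auto
    finally show ?thesis .
  qed
  have "{e \<in> M. b \<in> e} = {e \<in> M \<inter> Pow (V - {a}). b \<in> e} \<union> {e \<in> M. b \<in> e \<and> a \<in> e}"
    using assms(2) by (auto simp: pairs_def)
  moreover have "card ({e \<in> M \<inter> Pow (V - {a}). b \<in> e} \<union> {e \<in> M. b \<in> e \<and> a \<in> e})
    = card {e \<in> M \<inter> Pow (V - {a}). b \<in> e} + card {e \<in> M. b \<in> e \<and> a \<in> e}"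
    using fin by (intro card_Un_disjoint) auto
  ultimately show ?thesis
    by (simp add: deg_def * split: if_splits)
qed

lemma two_degs_le:
  assumes "finite V" "M \<subseteq> pairs V" "a \<noteq> b"
  shows "deg M a + deg M b \<le> card M + (if {a, b} \<in> M then 1 else 0)"
proof -
  have "finite (M \<inter> Pow (V - {a}))"
    using finite_missing[OF assms(1,2)] by simp
  from deg_le_card[OF this, of b] show ?thesis
    using card_restrict[OF assms(1,2), of a] deg_restrict[OF assms] by linarith
qed

lemma deg_insert:
  assumes "finite M" "{w, z} \<notin> M"
  shows "deg (insert {w, z} M) x = deg M x + (if x = w \<or> x = z then 1 else 0)"
proof -
  have "{e \<in> insert {w, z} M. x \<in> e}
      = (if x = w \<or> x = z then insert {w, z} {e \<in> M. x \<in> e} else {e \<in> M. x \<in> e})"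
    by auto
  then show ?thesis
    using assms by (simp add: deg_def)
qed

lemma handshake:
  assumes "finite V" "M \<subseteq> pairs V"
  shows "(\<Sum>x\<in>V. deg M x) = 2 * card M"
proof -
  have fin: "finite M"
    using assms by (rule finite_missing)
  have "(\<Sum>x\<in>V. deg M x) = (\<Sum>x\<in>V. \<Sum>e\<in>M. if x \<in> e then 1 else 0)"
  proof (rule sum.cong[OF refl])
    fix x
    have "{e \<in> M. x \<in> e} = M \<inter> {e. x \<in> e}"
      by auto
    then show "deg M x = (\<Sum>e\<in>M. if x \<in> e then 1 else 0)"
      using fin by (simp add: deg_def sum.If_cases)
  qed
  also have "\<dots> = (\<Sum>e\<in>M. \<Sum>x\<in>V. if x \<in> e then 1 else 0)"
    by (rule sum.swap)
  also have "\<dots> = (\<Sum>e\<in>M. 2)"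
  proof (rule sum.cong[OF refl])
    fix e assume "e \<in> M"
    then have "e \<subseteq> V" "card e = 2"
      using assms(2) by (auto simp: pairs_def)
    then have "V \<inter> {x. x \<in> e} = e"
      by auto
    then show "(\<Sum>x\<in>V. if x \<in> e then 1 else 0) = (2::nat)"
      using assms(1) \<open>card e = 2\<close> by (simp add: sum.If_cases)
  qed
  finally show ?thesis
    by simp
qed

lemma max_deg_vertex:
  assumes "finite V" "V \<noteq> {}"
  obtains v where "v \<in> V" "\<And>x. x \<in> V \<Longrightarrow> deg M x \<le> deg M v"
proof -
  have "Max (deg M ` V) \<in> deg M ` V"
    using assms by (intro Max_in) auto
  then obtain v where v: "v \<in> V" "deg M v = Max (deg M ` V)"
    by auto
  show ?thesis
    using assms(1) by (intro that[OF v(1)]) (simp add: v(2))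
qed

lemma min_deg_vertex:
  assumes "finite V" "V \<noteq> {}"
  obtains v where "v \<in> V" "\<And>x. x \<in> V \<Longrightarrow> deg M v \<le> deg M x"
proof -
  have "Min (deg M ` V) \<in> deg M ` V"
    using assms by (intro Min_in) auto
  then obtain v where v: "v \<in> V" "deg M v = Min (deg M ` V)"
    by auto
  show ?thesis
    using assms(1) by (intro that[OF v(1)]) (simp add: v(2))
qed

lemma twice_card_le:
  assumes "finite V" "M \<subseteq> pairs V" "\<And>x. x \<in> V \<Longrightarrow> deg M x \<le> k"
  shows "2 * card M \<le> k * card V"
proof -
  have "(\<Sum>x\<in>V. deg M x) \<le> (\<Sum>x\<in>V. k)"
    using assms(3) by (rule sum_mono)
  then show ?thesis
    using handshake[OF assms(1,2)] by (simp add: mult.commute)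
qed

lemma uncovered_vertex:
  assumes "finite V" "M \<subseteq> pairs V" "2 * card M < card V"
  obtains b where "b \<in> V" "deg M b = 0"
proof -
  have "\<not> (\<forall>x\<in>V. 1 \<le> deg M x)"
  proof
    assume "\<forall>x\<in>V. 1 \<le> deg M x"
    then have "(\<Sum>x\<in>V. 1) \<le> (\<Sum>x\<in>V. deg M x)"
      by (intro sum_mono) auto
    then show False
      using assms handshake[OF assms(1,2)] by simp
  qed
  then show ?thesis
    using that by (metis less_one linorder_not_le)
qed

lemma max_deg_pos:
  assumes "finite V" "M \<subseteq> pairs V" "M \<noteq> {}" "\<And>x. x \<in> V \<Longrightarrow> deg M x \<le> deg M v"
  shows "0 < deg M v"
proof -
  obtain e where e: "e \<in> M" "e \<in> pairs V"
    using assms(2,3) by blast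
  from e(2) obtain x y where xy: "e = {x, y}" "x \<in> V"
    by (rule pairsE)
  have "0 < deg M x"
    using e(1) xy(1) deg_pos_iff[OF finite_missing[OF assms(1,2)]] by blast
  then show ?thesis
    using assms(4)[OF xy(2)] by simp
qed

lemma not_adj_if_deg_0: "finite M \<Longrightarrow> deg M b = 0 \<Longrightarrow> b \<in> e \<Longrightarrow> e \<notin> M"
  by (auto simp: deg_def)

lemma deg_Un_le: "finite A \<Longrightarrow> finite B \<Longrightarrow> deg (A \<union> B) x \<le> deg A x + deg B x"
proof -
  have "{e \<in> A \<union> B. x \<in> e} = {e \<in> A. x \<in> e} \<union> {e \<in> B. x \<in> e}"
    by auto
  then show ?thesis
    unfolding deg_def by (metis card_Un_le)
qed

lemma restrict_pairs: "M \<subseteq> pairs V \<Longrightarrow> M \<inter> Pow U \<subseteq> pairs U"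
  by (auto simp: pairs_def)

lemma card_restrict2:
  assumes "finite V" "M \<subseteq> pairs V" "a \<noteq> b"
  shows "card (M \<inter> Pow (V - {a} - {b})) + deg M a + deg M b
      = card M + (if {a, b} \<in> M then 1 else 0)"
proof -
  have "M \<inter> Pow (V - {a}) \<inter> Pow (V - {a} - {b}) = M \<inter> Pow (V - {a} - {b})"
    by auto
  then have "card (M \<inter> Pow (V - {a} - {b})) + deg (M \<inter> Pow (V - {a})) b = card (M \<inter> Pow (V - {a}))"
    using card_restrict[of "V - {a}" "M \<inter> Pow (V - {a})" b] assms(1) restrict_pairs[OF assms(2)]
    by simp
  then show ?thesis
    using card_restrict[OF assms(1,2), of a] deg_restrict[OF assms] by linarith
qed

text \<open>If \<open>x\<close> kept degree \<open>s\<close>, then \<open>a\<close> would have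
  degree at least \<open>s\<close> too, and the pairs at \<open>a\<close> are not among those kept,
  so \<open>M\<close> would have \<open>2 * s\<close> pairs. This is how degree bounds survive the
  deletion of a vertex of maximum degree.\<close>

lemma deg_restrict_max:
  assumes "finite V" "M \<subseteq> pairs V" "x \<noteq> a" "deg M x \<le> deg M a" "card M < 2 * s"
  shows "deg (M \<inter> Pow (V - {a})) x < s"
proof (rule ccontr)
  let ?M = "M \<inter> Pow (V - {a})"
  assume "\<not> deg ?M x < s"
  moreover have "deg ?M x \<le> deg M x"
    using deg_restrict[OF assms(1,2), of a x] assms(3) by simp
  moreover have "deg ?M x \<le> card ?M"
    using finite_missing[OF assms(1,2)] by (intro deg_le_card) simp
  ultimately show False
    using card_restrict[OF assms(1,2), of a] assms(4,5) by linarith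
qed

text \<open>Two vertices share at most one pair, so two of degree \<open>s\<close> would force
  \<open>2 * s - 1\<close> pairs. Vertices of degree \<open>s\<close> are full: they cannot take a
  further missing edge.\<close>

lemma few_full:
  assumes "finite V" "M \<subseteq> pairs V" "card M + 1 < 2 * s"
  shows "card {x \<in> V. s \<le> deg M x} \<le> 1"
proof -
  have "x = y" if "x \<in> {x \<in> V. s \<le> deg M x}" "y \<in> {x \<in> V. s \<le> deg M x}" for x y
  proof (rule ccontr)
    assume "x \<noteq> y"
    then show False
      using two_degs_le[OF assms(1,2)] that assms(3) by (fastforce split: if_splits)
  qed
  then show ?thesis
    using assms(1) by (auto simp: card_le_Suc0_iff_eq)
qed

section \<open>Edge-disjoint connected spanning subgraphs\<close>

text \<open>Connectivity is expressed by cuts, so that no walks occur in the packing arguments; edges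
  of \<open>E\<close> that leave \<open>V\<close> do no harm.\<close>

definition conn :: "'a set \<Rightarrow> 'a set set \<Rightarrow> bool" where
  "conn V E \<longleftrightarrow> (\<forall>P. P \<subseteq> V \<and> P \<noteq> {} \<and> P \<noteq> V \<longrightarrow> (\<exists>x\<in>P. \<exists>y\<in>V - P. {x, y} \<in> E))"

text \<open>Connectedness by \<open>F\<close> after \<open>C\<close> is shrunk to a single vertex:
  \<open>F\<close> supplies the rest of a connected set whose core on \<open>C\<close> already
  exists.\<close>

definition attached :: "'a set \<Rightarrow> 'a set \<Rightarrow> 'a set set \<Rightarrow> bool" where
  "attached C W F \<longleftrightarrow> (\<forall>P. P \<subseteq> W \<and> P \<noteq> {} \<longrightarrow> (\<exists>x\<in>P. \<exists>y\<in>(C \<union> W) - P. {x, y} \<in> F))"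

lemma attached_empty: "attached C {} F"
  by (simp add: attached_def)

lemma attached_mono:
  assumes "attached C W F" "C \<subseteq> C'"
  shows "attached C' W F"
  unfolding attached_def
proof (intro allI impI)
  fix P assume "P \<subseteq> W \<and> P \<noteq> {}"
  then obtain x y where "x \<in> P" "y \<in> C \<union> W - P" "{x, y} \<in> F"
    using assms(1) unfolding attached_def by meson
  then show "\<exists>x\<in>P. \<exists>y\<in>C' \<union> W - P. {x, y} \<in> F"
    using assms(2) by (intro bexI[of _ x] bexI[of _ y]) auto
qed

lemma attached_common:
  assumes "z \<in> C" "z \<notin> W" "\<And>w. w \<in> W \<Longrightarrow> {w, z} \<in> F"
  shows "attached C W F"
  using assms unfolding attached_def by blast

text \<open>Once \<open>w\<close> hangs on \<open>z\<close>, it counts as part of the core for the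
  vertices that follow.\<close>

lemma attached_insert:
  assumes "z \<in> C" "z \<notin> insert w W" "{w, z} \<in> F" "attached (insert w C) W F"
  shows "attached C (insert w W) F"
  unfolding attached_def
proof (intro allI impI)
  fix P assume P: "P \<subseteq> insert w W \<and> P \<noteq> {}"
  show "\<exists>x\<in>P. \<exists>y\<in>C \<union> insert w W - P. {x, y} \<in> F"
  proof (cases "w \<in> P")
    case True
    have "z \<in> C \<union> insert w W - P"
      using assms(1,2) P by auto
    then show ?thesis
      using True assms(3) by blast
  next
    case False
    then have "P \<subseteq> W"
      using P by auto
    then have "\<exists>x\<in>P. \<exists>y\<in>(insert w C \<union> W) - P. {x, y} \<in> F"
      using assms(4) P unfolding attached_def by meson
    then show ?thesis
      by simp
  qed
qed

lemma connD:
  assumes "conn V E" "P \<subseteq> V" "P \<noteq> {}" "P \<noteq> V"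
  obtains x y where "x \<in> P" "y \<in> V - P" "{x, y} \<in> E"
  using assms unfolding conn_def by blast

lemma conn_attached:
  assumes C: "conn C E" and W: "attached C W F"
  shows "conn (C \<union> W) (E \<union> F)"
  unfolding conn_def
proof (intro allI impI)
  fix P assume P: "P \<subseteq> C \<union> W \<and> P \<noteq> {} \<and> P \<noteq> C \<union> W"
  consider "P \<inter> C \<noteq> {}" "\<not> C \<subseteq> P" | "P \<inter> C = {}" | "C \<subseteq> P"
    by blast
  then show "\<exists>x\<in>P. \<exists>y\<in>C \<union> W - P. {x, y} \<in> E \<union> F"
  proof cases
    case 1
    then obtain x y where "x \<in> P \<inter> C" "y \<in> C - P \<inter> C" "{x, y} \<in> E"
      using connD[OF C, of "P \<inter> C"] by blast
    then show ?thesis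
      by blast
  next
    case 2
    then have "P \<subseteq> W"
      using P by blast
    then show ?thesis
      using W P unfolding attached_def by blast
  next
    case 3
    then have "C \<union> W - P \<subseteq> W" "C \<union> W - P \<noteq> {}"
      using P by blast+
    then obtain x y where "x \<in> C \<union> W - P" "y \<in> (C \<union> W) - (C \<union> W - P)" "{x, y} \<in> F"
      using W unfolding attached_def by meson
    then show ?thesis
      by (intro bexI[of _ y] bexI[of _ x]) (auto simp: insert_commute)
  qed
qed

lemma conn_Un:
  assumes "conn A E" "conn B F" "A \<inter> B \<noteq> {}"
  shows "conn (A \<union> B) (E \<union> F)"
proof -
  have "attached A (B - A) F"
    unfolding attached_def
  proof (intro allI impI)
    fix P assume P: "P \<subseteq> B - A \<and> P \<noteq> {}"
    then have "P \<subseteq> B" "P \<noteq> {}" "P \<noteq> B"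
      using assms(3) by auto
    then obtain x y where "x \<in> P" "y \<in> B - P" "{x, y} \<in> F"
      using connD[OF assms(2)] by metis
    then show "\<exists>x\<in>P. \<exists>y\<in>A \<union> (B - A) - P. {x, y} \<in> F"
      by blast
  qed
  from conn_attached[OF assms(1) this] show ?thesis
    by simp
qed

lemma conn_star: "conn (insert a X) (star a X)"
  unfolding conn_def
proof (intro allI impI)
  fix P assume P: "P \<subseteq> insert a X \<and> P \<noteq> {} \<and> P \<noteq> insert a X"
  show "\<exists>x\<in>P. \<exists>y\<in>insert a X - P. {x, y} \<in> star a X"
  proof (cases "a \<in> P")
    case True
    then obtain y where "y \<in> X - P"
      using P by auto
    then show ?thesis
      using True by (auto simp: star_def)
  next
    case False
    then obtain x where "x \<in> P" "x \<in> X"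
      using P by auto
    then show ?thesis
      using False by (intro bexI[of _ x] bexI[of _ a]) (auto simp: star_def insert_commute)
  qed
qed

lemma conn_leaf:
  assumes "conn V E" "x \<in> V"
  shows "conn (insert a V) (insert {a, x} E)"
  using conn_Un[OF assms(1) conn_star[of x "{a}"]] assms(2)
  by (auto simp: star_def insert_commute insert_absorb)

lemma conn_restrict: "conn U F \<Longrightarrow> conn U (F \<inter> Pow U)"
  unfolding conn_def
proof (intro allI impI)
  fix P assume *: "\<forall>P. P \<subseteq> U \<and> P \<noteq> {} \<and> P \<noteq> U \<longrightarrow> (\<exists>x\<in>P. \<exists>y\<in>U - P. {x, y} \<in> F)"
    and P: "P \<subseteq> U \<and> P \<noteq> {} \<and> P \<noteq> U"
  then obtain x y where "x \<in> P" "y \<in> U - P" "{x, y} \<in> F"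
    by meson
  then show "\<exists>x\<in>P. \<exists>y\<in>U - P. {x, y} \<in> F \<inter> Pow U"
    using P by (intro bexI[of _ x] bexI[of _ y]) auto
qed

text \<open>Connected sets instead of trees: surplus edges may stay in them until
  \<open>tree_of_conn\<close> thins them out.\<close>

definition pack :: "nat \<Rightarrow> 'a set \<Rightarrow> 'a set set \<Rightarrow> bool" where
  "pack t V E \<longleftrightarrow> (\<exists>f. (\<forall>i<t. f i \<subseteq> E \<and> conn V (f i)) \<and>
     (\<forall>i<t. \<forall>j<t. i \<noteq> j \<longrightarrow> f i \<inter> f j = {}))"

lemma pack_mono: "pack t V E \<Longrightarrow> E \<subseteq> F \<Longrightarrow> pack t V F"
  unfolding pack_def by (meson subset_trans)

lemma pack_0: "pack 0 V E"
  by (simp add: pack_def)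

lemma pack_Suc:
  assumes "pack t V E" "conn V T" "E \<inter> T = {}"
  shows "pack (Suc t) V (E \<union> T)"
proof -
  obtain f where f: "\<forall>i<t. f i \<subseteq> E \<and> conn V (f i)"
    "\<forall>i<t. \<forall>j<t. i \<noteq> j \<longrightarrow> f i \<inter> f j = {}"
    using assms(1) unfolding pack_def by blast
  have "\<forall>i<Suc t. (f(t := T)) i \<subseteq> E \<union> T \<and> conn V ((f(t := T)) i)"
    using f(1) assms(2) by (auto simp: less_Suc_eq)
  moreover have "\<forall>i<Suc t. \<forall>j<Suc t. i \<noteq> j \<longrightarrow> (f(t := T)) i \<inter> (f(t := T)) j = {}"
    using f assms(3) by (simp add: less_Suc_eq) blast
  ultimately show ?thesis
    unfolding pack_def by blast
qed

text \<open>An injection of the indices into \<open>Q\<close> gives every tree its own edge at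
  \<open>a\<close>.\<close>

lemma pack_leaf:
  assumes "pack t V E" "Q \<subseteq> V" "finite Q" "t \<le> card Q" "\<forall>e\<in>E. a \<notin> e"
  shows "pack t (insert a V) (E \<union> star a Q)"
proof -
  obtain f where f: "\<forall>i<t. f i \<subseteq> E \<and> conn V (f i)"
    "\<forall>i<t. \<forall>j<t. i \<noteq> j \<longrightarrow> f i \<inter> f j = {}"
    using assms(1) unfolding pack_def by blast
  obtain q where q: "inj_on q {..<t}" "q ` {..<t} \<subseteq> Q"
    using card_le_inj[of "{..<t}" Q] assms(3,4) by auto
  let ?g = "\<lambda>i. insert {a, q i} (f i)"
  have "?g i \<subseteq> E \<union> star a Q \<and> conn (insert a V) (?g i)" if "i < t" for i
  proof -
    have "q i \<in> Q"
      using q(2) that by auto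
    then show ?thesis
      using f(1) that assms(2) by (auto simp: star_def intro!: conn_leaf)
  qed
  moreover have "?g i \<inter> ?g j = {}" if "i < t" "j < t" "i \<noteq> j" for i j
  proof -
    have "q i \<noteq> q j"
      using q(1) that by (auto dest: inj_onD)
    moreover have "{a, q i} \<notin> f j" "{a, q j} \<notin> f i"
      using f(1) assms(5) that by blast+
    ultimately show ?thesis
      using f(2) that by (auto simp: doubleton_eq_iff)
  qed
  ultimately show ?thesis
    unfolding pack_def by (intro exI[of _ ?g]) blast
qed

text \<open>The vertices of \<open>W\<close> are hung on the core one at a time, and each then joins
  the core. The new pair enters \<open>M\<close> while its vertex leaves \<open>W\<close>, so
  \<open>card M + card W\<close> is invariant and at most one vertex is full at any time. For
  \<open>w\<close> only that vertex and the \<open>M\<close>-neighbours are forbidden, which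
  explains \<open>deg M w + 2 \<le> card C\<close>.\<close>

lemma greedy_attach:
  assumes "finite W" "finite C" "C \<inter> W = {}" "M \<subseteq> pairs (C \<union> W)"
    and "card M + card W < 2 * s"
    and "\<And>x. x \<in> C \<union> W \<Longrightarrow> deg M x \<le> s"
    and "\<And>w. w \<in> W \<Longrightarrow> deg M w < s \<and> deg M w + 2 \<le> card C"
  obtains F where "F \<subseteq> pairs (C \<union> W) - M" "card F \<le> card W" "attached C W F"
    "\<And>x. x \<in> C \<union> W \<Longrightarrow> deg (M \<union> F) x \<le> s"
  using assms
proof (induction W arbitrary: C M thesis rule: finite_induct)
  case empty
  show ?case
    by (rule empty(1)[of "{}"]) (use empty in \<open>auto simp: attached_def\<close>)
next
  case (insert w W)
  let ?V = "C \<union> insert w W"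
  have finV: "finite ?V" and finM: "finite M"
    using insert finite_missing[of ?V M] by auto
  have w: "w \<notin> C" "deg M w < s" "deg M w + 2 \<le> card C"
    using insert.prems by auto
  define full where "full = {z \<in> C. s \<le> deg M z}"
  have "full \<subseteq> {x \<in> ?V. s \<le> deg M x}"
    by (auto simp: full_def)
  then have "card full \<le> card {x \<in> ?V. s \<le> deg M x}"
    using finV by (intro card_mono) auto
  also have "\<dots> \<le> 1"
    using insert.prems(5) insert.hyps by (intro few_full[OF finV insert.prems(4)]) simp
  finally have "card full \<le> 1" .
  moreover have "card {y \<in> C. {w, y} \<in> M} \<le> deg M w"
    unfolding deg_eq_card_nbrs[OF insert.prems(4)] using finV by (intro card_mono) auto
  ultimately have "card ({y \<in> C. {w, y} \<in> M} \<union> full) < card C"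
    using w(3) card_Un_le[of "{y \<in> C. {w, y} \<in> M}" full] by linarith
  then have "\<not> C \<subseteq> {y \<in> C. {w, y} \<in> M} \<union> full"
    using finV by (metis (no_types, lifting) card_mono finite_Un finite_subset full_def mem_Collect_eq
        linorder_not_less subsetI)
  then obtain z where "z \<in> C" "z \<notin> {y \<in> C. {w, y} \<in> M} \<union> full"
    by blast
  then have z: "z \<in> C" "{w, z} \<notin> M" "deg M z < s"
    by (simp_all add: full_def)
  then have wz: "w \<noteq> z"
    using w(1) by auto
  define M1 where "M1 = insert {w, z} M"
  have deg1: "deg M1 x = deg M x + (if x = w \<or> x = z then 1 else 0)" for x
    unfolding M1_def by (rule deg_insert[OF finM z(2)])
  have eq: "insert w C \<union> W = ?V"
    by auto
  have c1: "M1 \<subseteq> pairs (insert w C \<union> W)"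
    using insert.prems(4) z wz by (auto simp: M1_def eq doubleton_in_pairs)
  have c2: "card M1 + card W < 2 * s"
    using insert.prems(5) insert.hyps finM z(2) by (simp add: M1_def)
  have c3: "deg M1 x \<le> s" if "x \<in> insert w C \<union> W" for x
    using insert.prems(6)[of x] that w(2) z(3) by (auto simp: deg1)
  have c4: "deg M1 x < s \<and> deg M1 x + 2 \<le> card (insert w C)" if "x \<in> W" for x
  proof -
    have "x \<noteq> w" "x \<noteq> z"
      using that insert.hyps insert.prems(3) z(1) by auto
    then show ?thesis
      using insert.prems(7)[of x] that w(1) insert.prems(2) by (simp add: deg1)
  qed
  have fc: "finite (insert w C)" "insert w C \<inter> W = {}"
    using insert.prems(2,3) insert.hyps by auto
  obtain F where F: "F \<subseteq> pairs (insert w C \<union> W) - M1" "card F \<le> card W"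
    "attached (insert w C) W F" "\<And>x. x \<in> insert w C \<union> W \<Longrightarrow> deg (M1 \<union> F) x \<le> s"
    by (rule insert.IH[OF _ fc c1 c2 c3 c4]) blast
  have "attached (insert w C) W (insert {w, z} F)"
    using F(3) unfolding attached_def by blast
  moreover have "z \<notin> insert w W"
    using z(1) wz insert.prems(3) by auto
  ultimately have "attached C (insert w W) (insert {w, z} F)"
    by (intro attached_insert[OF z(1)]) simp_all
  moreover have "insert {w, z} F \<subseteq> pairs ?V - M"
    using F(1) z wz by (auto simp: eq M1_def doubleton_in_pairs)
  moreover have "card (insert {w, z} F) \<le> card (insert w W)"
    using F(2) insert.hyps card_insert_le_m1[of "Suc (card W)" F "{w, z}"] by simp
  moreover have "deg (M \<union> insert {w, z} F) x \<le> s" if "x \<in> ?V" for x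
    using F(4)[of x] that by (simp add: M1_def eq)
  ultimately show ?case
    using insert.prems(1) by blast
qed

lemma restrict_subset: "U \<subseteq> V \<Longrightarrow> pairs U - (M \<inter> Pow U \<union> F) \<subseteq> pairs V - M"
  by (auto simp: pairs_def)

text \<open>The new tree consists of a star from \<open>a\<close> to \<open>X\<close>, a star from
  \<open>b\<close> to \<open>Y\<close>, and \<open>F\<close>, which hangs \<open>W\<close> on them.
  The stars meet through the edge \<open>{a, b}\<close> or through a common vertex. The edges from
  \<open>a\<close> to \<open>R - X\<close> and from \<open>b\<close> to \<open>R - Y\<close> remain
  for making \<open>a\<close> and \<open>b\<close> leaves of the \<open>t\<close> old trees, hence
  the two counts.\<close>

lemma pack_step:
  assumes fin: "finite R" and ab: "a \<noteq> b" "a \<notin> R" "b \<notin> R"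
    and XY: "X \<subseteq> R" "Y \<subseteq> R" "X \<union> Y \<union> W = R"
    and X: "\<And>x. x \<in> X \<Longrightarrow> {a, x} \<notin> M" and Y: "\<And>y. y \<in> Y \<Longrightarrow> {b, y} \<notin> M"
    and link: "{a, b} \<notin> M \<or> X \<inter> Y \<noteq> {}"
    and F: "F \<subseteq> pairs R - M" "attached (X \<union> Y) W F"
    and Qa: "t \<le> card {x \<in> R - X. {a, x} \<notin> M}" and Qb: "t \<le> card {x \<in> R - Y. {b, x} \<notin> M}"
    and pack: "pack t R (pairs R - (M \<inter> Pow R \<union> F))"
  shows "pack (Suc t) (insert a (insert b R)) (pairs (insert a (insert b R)) - M)"
proof -
  let ?V = "insert a (insert b R)"
  let ?Qa = "{x \<in> R - X. {a, x} \<notin> M}" and ?Qb = "{x \<in> R - Y. {b, x} \<notin> M}"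
  let ?E0 = "pairs R - (M \<inter> Pow R \<union> F)"
  have a0: "\<forall>e\<in>?E0. a \<notin> e" and b0: "\<forall>e\<in>?E0. b \<notin> e"
    using ab by (auto simp: pairs_def)
  have "pack t (insert b R) (?E0 \<union> star b ?Qb)"
    using pack Qb b0 fin by (intro pack_leaf) auto
  then have p: "pack t ?V (?E0 \<union> star b ?Qb \<union> star a ?Qa)"
  proof (rule pack_leaf)
    show "\<forall>e\<in>?E0 \<union> star b ?Qb. a \<notin> e"
      using a0 ab by (auto simp: star_def)
  qed (use fin Qa in auto)
  \<comment> \<open>If it is not missing, the edge \<open>{a, b}\<close> is treated as one more ray
    of the star at \<open>a\<close>.\<close>
  define X' where "X' = (if {a, b} \<in> M then X else insert b X)"
  have "insert a X' \<inter> insert b Y \<noteq> {}"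
    using link by (auto simp: X'_def)
  then have "conn (insert a X' \<union> insert b Y) (star a X' \<union> star b Y)"
    by (intro conn_Un conn_star)
  moreover have "insert a X' \<union> insert b Y = {a, b} \<union> (X \<union> Y)"
    by (auto simp: X'_def)
  moreover have "attached ({a, b} \<union> (X \<union> Y)) W F"
    using F(2) by (rule attached_mono) auto
  ultimately have "conn ({a, b} \<union> (X \<union> Y) \<union> W) (star a X' \<union> star b Y \<union> F)"
    using conn_attached[of "{a, b} \<union> (X \<union> Y)" "star a X' \<union> star b Y" W F] by simp
  moreover have "{a, b} \<union> (X \<union> Y) \<union> W = ?V"
    using XY(3) by blast
  ultimately have c: "conn ?V (star a X' \<union> star b Y \<union> F)"
    by simp
  have dj: "(?E0 \<union> star b ?Qb \<union> star a ?Qa) \<inter> (star a X' \<union> star b Y \<union> F) = {}"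
  proof -
    have 1: "?E0 \<inter> star a X' = {}" "?E0 \<inter> star b Y = {}" "?E0 \<inter> F = {}"
      using a0 b0 by (auto simp: star_def)
    have 2: "star b ?Qb \<inter> F = {}" "star a ?Qa \<inter> F = {}"
      using F(1) ab by (auto simp: star_def doubleton_in_pairs)
    have 3: "star b ?Qb \<inter> star b Y = {}" "star a ?Qa \<inter> star a X' = {}"
      "star b ?Qb \<inter> star a X' = {}" "star a ?Qa \<inter> star b Y = {}"
      using ab XY(1,2) by (auto simp: star_def X'_def doubleton_eq_iff split: if_splits)
    show ?thesis
      by (simp only: Int_Un_distrib Int_Un_distrib2 1 2 3 Un_empty)
  qed
  have s1: "star a X' \<subseteq> pairs ?V - M" "star b Y \<subseteq> pairs ?V - M"
    using X Y XY ab by (auto simp: star_def X'_def doubleton_in_pairs split: if_splits)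
  have s2: "star a ?Qa \<subseteq> pairs ?V - M" "star b ?Qb \<subseteq> pairs ?V - M"
    using ab by (auto simp: star_def doubleton_in_pairs)
  have s3: "?E0 \<subseteq> pairs ?V - M"
    by (rule restrict_subset) auto
  have s4: "F \<subseteq> pairs ?V - M"
    using F(1) pairs_mono[of R ?V] by blast
  show ?thesis
    by (rule pack_mono[OF pack_Suc[OF p c dj]]) (intro Un_least s1 s2 s3 s4)
qed

lemma pack_remove:
  assumes fin: "finite V" and M: "M \<subseteq> pairs V" and v: "v \<in> V" "deg M v + t + 1 \<le> card V"
    and pack: "pack t (V - {v}) (pairs (V - {v}) - M \<inter> Pow (V - {v}))"
  shows "pack t V (pairs V - M)"
proof -
  let ?Q = "{x \<in> V - {v}. {v, x} \<notin> M}"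
  let ?E0 = "pairs (V - {v}) - M \<inter> Pow (V - {v})"
  have "pack t (insert v (V - {v})) (?E0 \<union> star v ?Q)"
    using fin v(2) card_non_nbrs[OF fin M v(1)]
    by (intro pack_leaf[OF pack]) (auto simp: pairs_def)
  moreover have "?E0 \<union> star v ?Q \<subseteq> pairs V - M"
    using v(1) by (auto simp: star_def doubleton_in_pairs pairs_def)
  ultimately show ?thesis
    using v(1) by (simp add: insert_absorb pack_mono)
qed

text \<open>Packings that connect \<open>V - {v}\<close>, with \<open>v\<close> as an optional additional vertex.\<close>

definition spack :: "nat \<Rightarrow> 'a set \<Rightarrow> 'a \<Rightarrow> 'a set set \<Rightarrow> bool" where
  "spack t V v E \<longleftrightarrow> (\<exists>f. (\<forall>i<t. f i \<subseteq> E \<and> (conn V (f i) \<or> conn (V - {v}) (f i))) \<and>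
     (\<forall>i<t. \<forall>j<t. i \<noteq> j \<longrightarrow> f i \<inter> f j = {}))"

lemma spack_mono: "spack t V v E \<Longrightarrow> E \<subseteq> F \<Longrightarrow> spack t V v F"
  unfolding spack_def
proof (elim exE conjE, intro exI conjI)
  fix f assume "\<forall>i<t. f i \<subseteq> E \<and> (conn V (f i) \<or> conn (V - {v}) (f i))" "E \<subseteq> F"
  then show "\<forall>i<t. f i \<subseteq> F \<and> (conn V (f i) \<or> conn (V - {v}) (f i))"
    by (metis subset_trans)
qed

lemma spack_pack: "pack t (V - {v}) E \<Longrightarrow> spack t V v E"
  unfolding spack_def pack_def
proof (elim exE conjE)
  fix f assume "\<forall>i<t. f i \<subseteq> E \<and> conn (V - {v}) (f i)"
    "\<forall>i<t. \<forall>j<t. i \<noteq> j \<longrightarrow> f i \<inter> f j = {}"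
  then show "\<exists>f. (\<forall>i<t. f i \<subseteq> E \<and> (conn V (f i) \<or> conn (V - {v}) (f i))) \<and>
     (\<forall>i<t. \<forall>j<t. i \<noteq> j \<longrightarrow> f i \<inter> f j = {})"
    by (intro exI[of _ f]) simp
qed

lemma spack_Suc:
  assumes "pack t (V - {v}) E" "conn V T" "E \<inter> T = {}"
  shows "spack (Suc t) V v (E \<union> T)"
proof -
  obtain f where f: "\<forall>i<t. f i \<subseteq> E \<and> conn (V - {v}) (f i)"
    "\<forall>i<t. \<forall>j<t. i \<noteq> j \<longrightarrow> f i \<inter> f j = {}"
    using assms(1) unfolding pack_def by blast
  have "\<forall>i<Suc t. (f(t := T)) i \<subseteq> E \<union> T \<and> (conn V ((f(t := T)) i) \<or> conn (V - {v}) ((f(t := T)) i))"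
    using f(1) assms(2) by (auto simp: less_Suc_eq)
  moreover have "\<forall>i<Suc t. \<forall>j<Suc t. i \<noteq> j \<longrightarrow> (f(t := T)) i \<inter> (f(t := T)) j = {}"
    using f assms(3) by (simp add: less_Suc_eq) blast
  ultimately show ?thesis
    unfolding spack_def by blast
qed

text \<open>Only one tree visits \<open>v\<close>: the star from \<open>v\<close> to
  \<open>Z\<close>, completed by \<open>F\<close>. The other trees live in \<open>V - {v}\<close>,
  where \<open>F\<close> is missing in addition, so the edges at \<open>v\<close> do not have to be
  shared out.\<close>

lemma spack_hub:
  assumes v: "v \<in> V" and Z: "Z \<subseteq> V - {v}" "\<And>z. z \<in> Z \<Longrightarrow> {v, z} \<notin> M"
    and F: "F \<subseteq> pairs (V - {v}) - M" "attached Z (V - {v} - Z) F"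
    and pack: "pack t (V - {v}) (pairs (V - {v}) - (M \<inter> Pow (V - {v}) \<union> F))"
  shows "spack (Suc t) V v (pairs V - M)"
proof -
  let ?E0 = "pairs (V - {v}) - (M \<inter> Pow (V - {v}) \<union> F)"
  have "attached (insert v Z) (V - {v} - Z) F"
    using F(2) by (rule attached_mono) auto
  from conn_attached[OF conn_star this]
  have "conn (insert v Z \<union> (V - {v} - Z)) (star v Z \<union> F)" .
  moreover have "insert v Z \<union> (V - {v} - Z) = V"
    using v Z(1) by blast
  ultimately have c: "conn V (star v Z \<union> F)"
    by simp
  have "?E0 \<inter> (star v Z \<union> F) = {}"
    by (auto simp: star_def pairs_def)
  from spack_Suc[OF pack c this] have "spack (Suc t) V v (?E0 \<union> (star v Z \<union> F))" .
  moreover have s1: "star v Z \<subseteq> pairs V - M"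
    using v Z by (auto simp: star_def doubleton_in_pairs)
  moreover have s2: "F \<subseteq> pairs V - M"
    using F(1) pairs_mono[of "V - {v}" V] by blast
  moreover have s3: "?E0 \<subseteq> pairs V - M"
    by (rule restrict_subset) auto
  ultimately show ?thesis
    by (elim spack_mono) (intro Un_least s1 s2 s3)
qed

section \<open>Packings in nearly complete graphs\<close>

text \<open>Each of \<open>a\<close> and \<open>b\<close> spends one half of \<open>R\<close> on the
  double star and the other half on its leaf edges. There is no slack: \<open>t\<close> spanning
  trees on \<open>2 * t\<close> vertices use every edge.\<close>

lemma pack_complete_even: "finite V \<Longrightarrow> card V = 2 * t \<Longrightarrow> pack t V (pairs V)"
proof (induction t arbitrary: V)
  case (Suc t)
  obtain U where U: "U \<subseteq> V" "card U = 2"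
    using Suc.prems(2) obtain_subset_with_card_n[of 2 V] by auto
  then obtain a b where ab: "a \<noteq> b" "a \<in> V" "b \<in> V"
    by (auto simp: card_2_iff)
  define R where "R = V - {a, b}"
  have R: "V = insert a (insert b R)" "a \<notin> R" "b \<notin> R" "finite R"
    using ab Suc.prems(1) by (auto simp: R_def)
  then have card_R: "card R = 2 * t"
    using Suc.prems(2) ab(1) by simp
  then obtain X where X: "X \<subseteq> R" "card X = t"
    using obtain_subset_with_card_n[of t R] by auto
  have "card (R - X) = t"
    using X card_R R(4) by (simp add: card_Diff_subset finite_subset)
  moreover have "{x \<in> R. x \<notin> X} = R - X" "{x \<in> R. x \<in> R \<longrightarrow> x \<in> X} = X"
    using X(1) by auto
  ultimately have c: "card {x \<in> R. x \<notin> X} = t" "card {x \<in> R. x \<in> R \<longrightarrow> x \<in> X} = t"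
    using X(2) by simp_all
  have "pack (Suc t) (insert a (insert b R)) (pairs (insert a (insert b R)) - {})"
    by (rule pack_step[where X = X and Y = "R - X" and W = "{}" and F = "{}"])
      (use R ab X c Suc.IH[OF R(4) card_R] in \<open>auto simp: attached_empty\<close>)
  then show ?case
    using R(1) by simp
qed (simp add: pack_0)

text \<open>The bound is the edge count: \<open>t\<close> spanning trees need
  \<open>2 * t * t\<close> of the \<open>t * (2 * t + 1)\<close> edges. The induction therefore has
  to get rid of one missing pair per step: the \<open>d\<close> pairs at \<open>a\<close> disappear
  and at most \<open>d - 1\<close> come back as \<open>F\<close>.\<close>

lemma pack_odd:
  assumes "finite V" "M \<subseteq> pairs V" "card V = 2 * t + 1" "card M \<le> t"
  shows "pack t V (pairs V - M)"
  using assms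
proof (induction t arbitrary: V M)
  case (Suc t)
  have finM: "finite M"
    using Suc.prems finite_missing by blast
  obtain b where b: "b \<in> V" "deg M b = 0"
    using uncovered_vertex[OF Suc.prems(1,2)] Suc.prems(3,4) by auto
  obtain a where a: "a \<in> V - {b}" "\<And>x. x \<in> V - {b} \<Longrightarrow> deg M x \<le> deg M a"
  proof (rule max_deg_vertex)
    show "V - {b} \<noteq> {}"
    proof
      assume "V - {b} = {}"
      then have "card V \<le> card {b}"
        by (intro card_mono) auto
      then show False
        using Suc.prems(3) by simp
    qed
  qed (use Suc.prems(1) in auto)
  define R where "R = V - {a, b}"
  define d where "d = deg M a"
  have R: "V = insert a (insert b R)" "a \<notin> R" "b \<notin> R" "finite R" "a \<noteq> b"
    using a(1) b(1) Suc.prems(1) by (auto simp: R_def)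
  have card_R: "card R = 2 * t + 1"
    using Suc.prems(3) R by simp
  define A where "A = {x \<in> R. {a, x} \<in> M}"
  have "{y \<in> V. {a, y} \<in> M} = A"
    using Suc.prems(2) not_adj_if_deg_0[OF finM b(2)] by (auto simp: A_def R_def pairs_def)
  then have card_A: "card A = d"
    using deg_eq_card_nbrs[OF Suc.prems(2), of a] by (simp add: d_def)
  have dt: "d \<le> Suc t"
    using deg_le_card[OF finM, of a] Suc.prems(4) by (simp add: d_def)
  have finA: "finite A" "A \<subseteq> R"
    using R(4) by (auto simp: A_def)
  have sub: "M \<inter> Pow R \<subseteq> pairs R"
    using Suc.prems(2) by (auto simp: pairs_def)
  have cM: "card (M \<inter> Pow R) + d = card M"
  proof -
    have "M \<inter> Pow (V - {a}) = M \<inter> Pow R"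
      using not_adj_if_deg_0[OF finM b(2)] by (auto simp: R_def)
    then show ?thesis
      using card_restrict[OF Suc.prems(1,2), of a] by (simp add: d_def)
  qed
  \<comment> \<open>No edge at \<open>b\<close> is missing, so \<open>b\<close> takes over all
    vertices of \<open>A\<close>, which \<open>a\<close> cannot reach; \<open>t\<close> vertices
    outside \<open>Y\<close> are left for its leaf edges.\<close>
  obtain Y where Y: "A \<subseteq> Y" "Y \<subseteq> R" "card Y = Suc t"
    using exists_subset_between[of A "Suc t" R] finA card_A dt card_R R(4) by auto
  have cRY: "card (R - Y) = t"
    using Y card_R R(4) by (simp add: card_Diff_subset finite_subset)
  then have "d - 1 \<le> card (R - Y)"
    using dt by simp
  \<comment> \<open>Outside \<open>M\<close>, \<open>a\<close> has \<open>2 * t + 1 - d\<close>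
    edges into \<open>R\<close> and must keep \<open>t\<close> of them as leaf edges. If
    \<open>d > 0\<close>, it can take only \<open>t + 1 - d\<close> of the \<open>t\<close> vertices
    outside \<open>Y\<close>; the other \<open>d - 1\<close> are left to \<open>F\<close>.\<close>
  then obtain W where W: "W \<subseteq> R - Y" "card W = d - 1"
    by (rule obtain_subset_with_card_n)
  define X where "X = R - Y - W"
  have fins: "finite Y" "finite W" "finite X"
    using Y W R(4) by (auto simp: X_def intro: finite_subset)
  have cX: "card X = t - (d - 1)"
    using cRY W fins by (simp add: X_def card_Diff_subset)
  have XYW: "X \<union> Y \<union> W = R" "(X \<union> Y) \<inter> W = {}"
    using W Y by (auto simp: X_def)
  have cXY: "card (X \<union> Y) = t - (d - 1) + Suc t"
    using cX Y(3) fins by (subst card_Un_disjoint) (auto simp: X_def)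
  have deg_small: "deg (M \<inter> Pow R) x \<le> card M - d" for x
    using deg_le_card[of "M \<inter> Pow R" x] finM cM by simp
  obtain F where F: "F \<subseteq> pairs (X \<union> Y \<union> W) - M \<inter> Pow R" "card F \<le> card W" "attached (X \<union> Y) W F"
    "\<And>x. x \<in> X \<union> Y \<union> W \<Longrightarrow> deg (M \<inter> Pow R \<union> F) x \<le> Suc t"
  proof (rule greedy_attach[where C = "X \<union> Y" and W = W and M = "M \<inter> Pow R" and s = "Suc t"])
    show "card (M \<inter> Pow R) + card W < 2 * Suc t"
      using cM W(2) Suc.prems(4) by (cases d) auto
    show "deg (M \<inter> Pow R) x \<le> Suc t" for x
      using deg_small[of x] Suc.prems(4) by linarith
    show "deg (M \<inter> Pow R) w < Suc t \<and> deg (M \<inter> Pow R) w + 2 \<le> card (X \<union> Y)" if "w \<in> W" for w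
    proof -
      have "d \<ge> 2"
        using that W(2) fins(2) by (cases "d \<le> 1") auto
      then show ?thesis
        using deg_small[of w] Suc.prems(4) cXY dt by linarith
    qed
  qed (use fins XYW sub in \<open>auto simp: XYW(1)\<close>)
  have F': "F \<subseteq> pairs R - M"
    using F(1) by (auto simp: XYW(1) pairs_def)
  have "pack (Suc t) (insert a (insert b R)) (pairs (insert a (insert b R)) - M)"
  proof (rule pack_step[where X = X and Y = Y and W = W and F = F])
    show "{a, x} \<notin> M" if "x \<in> X" for x
      using that Y by (auto simp: X_def A_def)
    show "{b, y} \<notin> M" for y
      using not_adj_if_deg_0[OF finM b(2)] by blast
    show "{a, b} \<notin> M \<or> X \<inter> Y \<noteq> {}"
      using not_adj_if_deg_0[OF finM b(2)] by blast
    show "t \<le> card {x \<in> R - Y. {b, x} \<notin> M}"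
    proof -
      have "{x \<in> R - Y. {b, x} \<notin> M} = R - Y"
        using not_adj_if_deg_0[OF finM b(2)] by blast
      then show ?thesis
        using cRY by simp
    qed
    show "t \<le> card {x \<in> R - X. {a, x} \<notin> M}"
    proof -
      have "{x \<in> R - X. {a, x} \<notin> M} = R - (X \<union> A)"
        by (auto simp: A_def)
      moreover have "card (R - (X \<union> A)) = 2 * t + 1 - card (X \<union> A)"
        using finA fins R(4) card_R by (subst card_Diff_subset) (auto simp: X_def)
      moreover have "card (X \<union> A) = t - (d - 1) + d"
        using cX card_A fins finA Y by (subst card_Un_disjoint) (auto simp: X_def)
      ultimately show ?thesis
        using dt by (cases d) auto
    qed
    \<comment> \<open>The gain of one pair needs \<open>d > 0\<close>. For empty \<open>M\<close>
      nothing is lost, but \<open>F\<close> is empty as well.\<close>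
    have "card (M \<inter> Pow R \<union> F) \<le> t"
    proof (cases "M = {}")
      case True
      then have "d = 0"
        by (simp add: d_def deg_def)
      then have "F = {}"
        using F(2) W(2) F' finite_pairs[OF R(4)] by (auto dest: finite_subset)
      then show ?thesis
        using True by simp
    next
      case False
      have "deg M x \<le> d" if "x \<in> V" for x
        using a(2)[of x] b(2) that by (cases "x = b") (auto simp: d_def)
      then have "0 < d"
        using max_deg_pos[OF Suc.prems(1,2) False, of a] by (simp add: d_def)
      then show ?thesis
        using card_Un_le[of "M \<inter> Pow R" F] F(2) W(2) cM Suc.prems(4) by linarith
    qed
    then show "pack t R (pairs R - (M \<inter> Pow R \<union> F))"
      using sub F' card_R R(4) by (intro Suc.IH) auto
  qed (use R F F' XYW in \<open>auto simp: X_def\<close>)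
  then show ?case
    using R(1) by simp
qed (simp add: pack_0)

text \<open>Deleting a vertex of maximum degree lowers \<open>card V\<close> by one and
  \<open>card M\<close> by at least one, unless \<open>M\<close> is empty; the vertex returns as a
  leaf. The descent ends at \<open>card V = 2 * t + 1\<close>, the case of
  \<open>pack_odd\<close>.\<close>

lemma pack_few_missing:
  assumes "finite V" "M \<subseteq> pairs V" "2 * t < card V" "card M + t < card V"
  shows "pack t V (pairs V - M)"
  using assms
proof (induction "card V" arbitrary: V M)
  case (Suc n)
  have finM: "finite M"
    using Suc.prems finite_missing by blast
  show ?case
  proof (cases "n = 2 * t")
    case True
    then show ?thesis
      using Suc by (intro pack_odd) auto
  next
    case False
    have "V \<noteq> {}"
      using Suc.hyps(2) by auto
    with Suc.prems(1) obtain v where v: "v \<in> V" "\<And>x. x \<in> V \<Longrightarrow> deg M x \<le> deg M v"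
      by (rule max_deg_vertex[where M = M]) blast
    have dv: "deg M v \<le> card M"
      by (rule deg_le_card[OF finM])
    have pos: "M = {} \<or> 0 < deg M v"
    proof (cases "M = {}")
      case False
      from max_deg_pos[OF Suc.prems(1,2) this v(2)] show ?thesis
        by simp
    qed simp
    have cV: "card (V - {v}) = n"
      using v(1) Suc.hyps(2) Suc.prems(1) by simp
    have cM: "card (M \<inter> Pow (V - {v})) + deg M v = card M"
      by (rule card_restrict[OF Suc.prems(1,2)])
    have "pack t (V - {v}) (pairs (V - {v}) - M \<inter> Pow (V - {v}))"
    proof (rule Suc.hyps(1))
      show "M \<inter> Pow (V - {v}) \<subseteq> pairs (V - {v})"
        using Suc.prems(2) by (auto simp: pairs_def)
      show "2 * t < card (V - {v})"
        using False cV Suc.hyps(2) Suc.prems(3) by linarith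
      show "card (M \<inter> Pow (V - {v})) + t < card (V - {v})"
      proof (cases "M = {}")
        case True
        then show ?thesis
          using False cV Suc.hyps(2) Suc.prems(3) by simp
      next
        case False
        then show ?thesis
          using pos cM cV Suc.hyps(2) Suc.prems(4) by linarith
      qed
    qed (use cV Suc.prems(1) in auto)
    moreover have "deg M v + t + 1 \<le> card V"
      using dv Suc.prems(4) by linarith
    ultimately show ?thesis
      by (rule pack_remove[OF Suc.prems(1,2) v(1), rotated])
  qed
qed auto

section \<open>The tight case \<open>card V = 2 * t + 2\<close> with a degree bound\<close>

lemma subset_avoiding:
  assumes "finite A" "finite B" "k = 0 \<or> k + card B \<le> card A"
  obtains W where "W \<subseteq> A - B" "card W = k" "finite W"
proof -
  have "k \<le> card (A - B)"
    using assms diff_card_le_card_Diff[of B A] by auto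
  then show ?thesis
    using that obtain_subset_with_card_n by metis
qed

text \<open>Taking \<open>s = t + 1\<close> in \<open>greedy_attach\<close> makes
  \<open>M \<inter> Pow R \<union> F\<close> obey the degree bound of the induction hypothesis. The
  condition \<open>card W \<le> t\<close> leaves a core of at least \<open>t + 2\<close> vertices,
  as many as a vertex of degree \<open>t\<close> requires.\<close>

lemma double_star_step:
  assumes fin: "finite R" and M: "M \<subseteq> pairs (insert a (insert b R))"
    and ab: "a \<noteq> b" "a \<notin> R" "b \<notin> R" and cR: "card R = 2 * t + 2"
    and IH: "\<And>M'. M' \<subseteq> pairs R \<Longrightarrow> card M' \<le> 2 * t + 1 \<Longrightarrow> (\<And>x. x \<in> R \<Longrightarrow> deg M' x \<le> t + 1)
        \<Longrightarrow> pack t R (pairs R - M')"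
    and XYW: "X \<subseteq> R" "Y \<subseteq> R" "X \<union> Y \<union> W = R" "(X \<union> Y) \<inter> W = {}"
    and X: "\<And>x. x \<in> X \<Longrightarrow> {a, x} \<notin> M" and Y: "\<And>y. y \<in> Y \<Longrightarrow> {b, y} \<notin> M"
    and link: "{a, b} \<notin> M \<or> X \<inter> Y \<noteq> {}"
    and Qa: "t \<le> card {x \<in> R - X. {a, x} \<notin> M}" and Qb: "t \<le> card {x \<in> R - Y. {b, x} \<notin> M}"
    and few: "card (M \<inter> Pow R) + card W \<le> 2 * t + 1" "card W \<le> t"
    and deg: "\<And>x. x \<in> R \<Longrightarrow> deg (M \<inter> Pow R) x \<le> t + 1"
    and degW: "\<And>w. w \<in> W \<Longrightarrow> deg (M \<inter> Pow R) w \<le> t"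
  shows "pack (Suc t) (insert a (insert b R)) (pairs (insert a (insert b R)) - M)"
proof -
  have fins: "finite W" "finite (X \<union> Y)" "finite (M \<inter> Pow R)"
    using XYW fin finite_missing[OF fin restrict_pairs[OF M]] by (auto intro: finite_subset)
  have "card (X \<union> Y) + card W = card R"
    using XYW(3,4) fins by (metis card_Un_disjoint)
  then have cC: "t + 2 \<le> card (X \<union> Y)"
    using cR few(2) by linarith
  obtain F where F: "F \<subseteq> pairs (X \<union> Y \<union> W) - M \<inter> Pow R" "card F \<le> card W" "attached (X \<union> Y) W F"
    "\<And>x. x \<in> X \<union> Y \<union> W \<Longrightarrow> deg (M \<inter> Pow R \<union> F) x \<le> t + 1"
  proof (rule greedy_attach[where C = "X \<union> Y" and W = W and M = "M \<inter> Pow R" and s = "t + 1"])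
    show "M \<inter> Pow R \<subseteq> pairs (X \<union> Y \<union> W)"
      using restrict_pairs[OF M] XYW(3) by simp
    show "card (M \<inter> Pow R) + card W < 2 * (t + 1)"
      using few(1) by simp
    show "deg (M \<inter> Pow R) x \<le> t + 1" if "x \<in> X \<union> Y \<union> W" for x
      using deg that XYW(3) by simp
    show "deg (M \<inter> Pow R) w < t + 1 \<and> deg (M \<inter> Pow R) w + 2 \<le> card (X \<union> Y)" if "w \<in> W" for w
      using degW[OF that] cC by simp
  qed (use fins XYW(4) in auto)
  have F': "F \<subseteq> pairs R - M"
    using F(1) unfolding XYW(3) by (auto simp: pairs_def)
  have pk: "pack t R (pairs R - (M \<inter> Pow R \<union> F))"
  proof (rule IH)
    show "M \<inter> Pow R \<union> F \<subseteq> pairs R"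
      using F' restrict_pairs[OF M] by blast
    show "card (M \<inter> Pow R \<union> F) \<le> 2 * t + 1"
      using card_Un_le[of "M \<inter> Pow R" F] F(2) few(1) by linarith
    show "deg (M \<inter> Pow R \<union> F) x \<le> t + 1" if "x \<in> R" for x
      using F(4) that XYW(3) by simp
  qed
  show ?thesis
    by (rule pack_step[OF fin ab XYW(1-3) X Y link F' F(3) Qa Qb pk])
qed

text \<open>Both bounds are necessary in general: a complete graph on \<open>2 * t + 2\<close>
  vertices has \<open>2 * t + 1\<close> edges more than \<open>t\<close> spanning trees need, and
  every vertex must keep \<open>t\<close> of its \<open>2 * t + 1\<close> edges. One step lowers the
  allowance for \<open>card M\<close> by two, so the size of the set attached by \<open>F\<close> is
  always chosen to make the loss at \<open>a\<close> and \<open>b\<close> exceed it by two.\<close>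

lemma pack_bounded_deg:
  assumes "finite V" "M \<subseteq> pairs V" "card V = 2 * t + 2" "card M \<le> 2 * t + 1"
    "\<And>x. x \<in> V \<Longrightarrow> deg M x \<le> t + 1"
  shows "pack t V (pairs V - M)"
  using assms
proof (induction t arbitrary: V M)
  case (Suc t)
  note fV = Suc.prems(1) and M = Suc.prems(2)
  show ?case
  proof (cases "card M + Suc t < card V")
    case True
    then show ?thesis
      using Suc.prems by (intro pack_few_missing) auto
  next
    case False
    then have many: "t + 3 \<le> card M"
      using Suc.prems(3) by simp
    have finM: "finite M"
      using fV M by (rule finite_missing)
    have "V \<noteq> {}"
      using Suc.prems(3) by auto
    with fV obtain a where a: "a \<in> V" "\<And>x. x \<in> V \<Longrightarrow> deg M x \<le> deg M a"
      by (rule max_deg_vertex[where M = M]) blast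
    define d where "d = deg M a"
    define A where "A = {x \<in> V. {a, x} \<in> M}"
    have A: "card A = d" "finite A" "a \<notin> A"
      using deg_eq_card_nbrs[OF M, of a] fV M by (auto simp: A_def d_def pairs_def)
    have d_le: "d \<le> t + 2"
      using Suc.prems(5)[OF a(1)] by (simp add: d_def)
    \<comment> \<open>Otherwise \<open>M\<close> is a matching and has at most \<open>t + 2\<close>
      pairs, which \<open>many\<close> excludes.\<close>
    have d_ge: "2 \<le> d"
    proof (rule ccontr)
      assume "\<not> 2 \<le> d"
      then have "deg M x \<le> 1" if "x \<in> V" for x
        using a(2)[OF that] by (simp add: d_def)
      then have "2 * card M \<le> 1 * card V"
        by (rule twice_card_le[OF fV M])
      then show False
        using many Suc.prems(3) by simp
    qed
    have R: "V = insert a (insert b (V - {a} - {b}))" "card (V - {a} - {b}) = 2 * t + 2"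
      if "b \<in> V" "b \<noteq> a" for b
      using that a(1) fV Suc.prems(3) by auto
    have degR: "deg (M \<inter> Pow (V - {a} - {b})) x \<le> t + 1" if "x \<noteq> a" "x \<in> V" for b x
    proof -
      have "deg (M \<inter> Pow (V - {a} - {b})) x \<le> deg (M \<inter> Pow (V - {a})) x"
        using finM by (intro deg_mono) auto
      moreover have "deg (M \<inter> Pow (V - {a})) x < t + 2"
        using deg_restrict_max[OF fV M that(1) a(2)[OF that(2)], of "t + 2"] Suc.prems(4) by simp
      ultimately show ?thesis
        by simp
    qed
    have step: "pack (Suc t) V (pairs V - M)"
      if b: "b \<in> V" "b \<noteq> a" and R_def: "R = V - {a} - {b}"
        and XYW: "X \<subseteq> R" "Y \<subseteq> R" "X \<union> Y \<union> W = R" "(X \<union> Y) \<inter> W = {}"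
        and X: "\<And>x. x \<in> X \<Longrightarrow> {a, x} \<notin> M" and Y: "\<And>y. y \<in> Y \<Longrightarrow> {b, y} \<notin> M"
        and link: "{a, b} \<notin> M \<or> X \<inter> Y \<noteq> {}"
        and Qa: "t \<le> card {x \<in> R - X. {a, x} \<notin> M}" and Qb: "t \<le> card {x \<in> R - Y. {b, x} \<notin> M}"
        and few: "card (M \<inter> Pow R) + card W \<le> 2 * t + 1" "card W \<le> t"
        and degW: "\<And>w. w \<in> W \<Longrightarrow> deg (M \<inter> Pow R) w \<le> t"
      for b R X Y W
    proof -
      have ab: "a \<noteq> b" "a \<notin> R" "b \<notin> R" and fR: "finite R" and M': "M \<subseteq> pairs (insert a (insert b R))"
        using b R(1)[OF b] M fV by (auto simp: R_def)
      have IH: "pack t R (pairs R - M')"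
        if "M' \<subseteq> pairs R" "card M' \<le> 2 * t + 1" "\<And>x. x \<in> R \<Longrightarrow> deg M' x \<le> t + 1" for M'
        using that R(2)[OF b] fR by (intro Suc.IH) (auto simp: R_def)
      have dR: "deg (M \<inter> Pow R) x \<le> t + 1" if "x \<in> R" for x
        using degR[of x b] that by (auto simp: R_def)
      have "pack (Suc t) (insert a (insert b R)) (pairs (insert a (insert b R)) - M)"
        by (rule double_star_step[OF fR M' ab _ IH XYW X Y link Qa Qb few dR degW])
          (use R(2)[OF b] in \<open>auto simp: R_def\<close>)
      then show ?thesis
        using R(1)[OF b] by (simp add: R_def)
    qed
    have full: "finite {x \<in> R. t + 1 \<le> deg (M \<inter> Pow R) x}"
      "card (M \<inter> Pow R) \<le> 2 * t \<Longrightarrow> card {x \<in> R. t + 1 \<le> deg (M \<inter> Pow R) x} \<le> 1"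
      if "R \<subseteq> V" for R
      using few_full[of R "M \<inter> Pow R" "t + 1"] finite_subset[OF that fV] restrict_pairs[OF M] by auto
    \<comment> \<open>The vertex \<open>b\<close> should miss as little as possible: nothing, or
      only \<open>a\<close>, or else one other vertex \<open>c\<close>. In the last case a vertex of
      degree one exists because the degree sum is at most \<open>4 * t + 6\<close>, less than
      \<open>2 * card V\<close>.\<close>
    consider (uncovered) b where "b \<in> V" "deg M b = 0"
      | (leaf_adj) b where "b \<in> A" "deg M b = 1"
      | (other) "\<And>x. x \<in> V \<Longrightarrow> 1 \<le> deg M x" "\<And>x. x \<in> A \<Longrightarrow> 2 \<le> deg M x"
    proof -
      have "x \<in> A \<Longrightarrow> x \<in> V" for x
        by (simp add: A_def)
      then show ?thesis
        using that by (metis One_nat_def Suc_1 Suc_leI le_neq_implies_less less_one not_less)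
    qed
    then show ?thesis
    proof cases
      case uncovered
      have ba: "b \<noteq> a"
        using uncovered d_ge by (auto simp: d_def)
      define R where "R = V - {a} - {b}"
      then have RV: "R \<subseteq> V"
        by blast
      note cR = R(2)[OF uncovered(1) ba, folded R_def]
      have nb: "e \<notin> M" if "b \<in> e" for e
        using not_adj_if_deg_0[OF finM uncovered(2) that] .
      have AR: "A \<subseteq> R" and finR: "finite R"
        using A(3) nb fV by (auto simp: A_def R_def)
      have cM: "card (M \<inter> Pow R) + d = card M"
        using card_restrict2[OF fV M ba[symmetric]] uncovered(2) nb by (simp add: R_def d_def)
      let ?full = "{x \<in> R. t + 1 \<le> deg (M \<inter> Pow R) x}"
      \<comment> \<open>For \<open>d = 2\<close> up to \<open>2 * t + 1\<close> pairs may remain,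
        one too many for \<open>few_full\<close>, but then \<open>W\<close> is empty.\<close>
      have "card ?full \<le> 1" if "2 < d"
      proof (rule full(2))
        show "card (M \<inter> Pow R) \<le> 2 * t"
          using that cM Suc.prems(4) by simp
      qed (rule RV)
      then have "d - 2 = 0 \<or> d - 2 + card ?full \<le> card A"
        using A(1) by linarith
      \<comment> \<open>Full vertices are avoided because each \<open>w\<close> must take a further
        pair. Being inside \<open>A\<close>, \<open>W\<close> is disjoint from \<open>X\<close>, and
        together they are the \<open>t\<close> vertices to which \<open>b\<close> keeps its leaf
        edges.\<close>
      then obtain W where W: "W \<subseteq> A - ?full" "card W = d - 2" "finite W"
        by (rule subset_avoiding[OF A(2) full(1)[OF RV]]) blast
      have cRA: "card (R - A) = 2 * t + 2 - d"
        using AR A cR by (simp add: card_Diff_subset)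
      then have "t + 2 - d \<le> card (R - A)"
        by simp
      then obtain X where X: "X \<subseteq> R - A" "card X = t + 2 - d" "finite X"
        by (rule obtain_subset_with_card_n)
      show ?thesis
      proof (rule step[OF uncovered(1) ba R_def, of X "R - W - X" W])
        show "t \<le> card {x \<in> R - X. {a, x} \<notin> M}"
        proof -
          have "{x \<in> R - X. {a, x} \<notin> M} = (R - A) - X"
            by (auto simp: A_def R_def)
          then show ?thesis
            using cRA X d_le d_ge by (simp add: card_Diff_subset)
        qed
        show "t \<le> card {x \<in> R - (R - W - X). {b, x} \<notin> M}"
        proof -
          have "{x \<in> R - (R - W - X). {b, x} \<notin> M} = W \<union> X"
            using nb W(1) X(1) AR by auto
          moreover have "card (W \<union> X) = card W + card X"
            using W X by (intro card_Un_disjoint) auto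
          ultimately show ?thesis
            using W(2) X(2) d_le d_ge by simp
        qed
        show "card (M \<inter> Pow R) + card W \<le> 2 * t + 1"
          using cM W(2) Suc.prems(4) d_ge by simp
        show "card W \<le> t"
          using W(2) d_le by simp
        show "deg (M \<inter> Pow R) w \<le> t" if "w \<in> W" for w
          using that W(1) AR by auto
      qed (use X(1) W(1) AR nb in \<open>auto simp: A_def R_def\<close>)
    next
      case leaf_adj
      then have bV: "b \<in> V" "b \<noteq> a"
        using A(3) by (auto simp: A_def)
      have abM: "{a, b} \<in> M"
        using leaf_adj(1) by (simp add: A_def)
      define R where "R = V - {a} - {b}"
      then have RV: "R \<subseteq> V"
        by blast
      note cR = R(2)[OF bV, folded R_def]
      define A' where "A' = A - {b}"
      have A': "card A' = d - 1" "finite A'" "A' \<subseteq> R"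
        using A leaf_adj(1) by (auto simp: A'_def R_def A_def)
      have nb: "{b, x} \<notin> M" if "x \<noteq> a" for x
      proof
        assume "{b, x} \<in> M"
        then have "{{a, b}, {b, x}} \<subseteq> {e \<in> M. b \<in> e}" "{a, b} \<noteq> {b, x}"
          using abM that bV(2) by (auto simp: doubleton_eq_iff)
        then have "2 \<le> deg M b"
          unfolding deg_def using finM card_mono[of "{e \<in> M. b \<in> e}" "{{a, b}, {b, x}}"] by simp
        then show False
          using leaf_adj(2) by simp
      qed
      have finR: "finite R"
        using fV by (auto simp: R_def)
      have cM: "card (M \<inter> Pow R) + d = card M"
        using card_restrict2[OF fV M bV(2)[symmetric]] leaf_adj(2) abM by (simp add: R_def d_def)
      let ?full = "{x \<in> R. t + 1 \<le> deg (M \<inter> Pow R) x}"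
      have "card ?full \<le> 1" if "2 < d"
      proof (rule full(2))
        show "card (M \<inter> Pow R) \<le> 2 * t"
          using that cM Suc.prems(4) by simp
      qed (rule RV)
      then have "d - 2 = 0 \<or> d - 2 + card ?full \<le> card A'"
        using A'(1) by linarith
      then obtain W where W: "W \<subseteq> A' - ?full" "card W = d - 2" "finite W"
        by (rule subset_avoiding[OF A'(2) full(1)[OF RV]]) blast
      have cRA: "card (R - A') = 2 * t + 3 - d"
        using A' cR d_ge by (simp add: card_Diff_subset)
      then have "t + 3 - d \<le> card (R - A')"
        by simp
      \<comment> \<open>One vertex more than in the previous case: \<open>b\<close> is itself one of
        the \<open>d\<close> vertices that \<open>a\<close> misses, so \<open>a\<close> has one more
        edge into \<open>R\<close>. It pays for the vertex \<open>z\<close> shared by both stars,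
        which replaces the missing edge \<open>{a, b}\<close>.\<close>
      then obtain X where X: "X \<subseteq> R - A'" "card X = t + 3 - d" "finite X"
        by (rule obtain_subset_with_card_n)
      have "X \<noteq> {}"
        using X(2) d_le by auto
      then obtain z where z: "z \<in> X"
        by blast
      show ?thesis
      proof (rule step[OF bV R_def, of X "insert z (R - W - X)" W])
        show "t \<le> card {x \<in> R - X. {a, x} \<notin> M}"
        proof -
          have "{x \<in> R - X. {a, x} \<notin> M} = (R - A') - X"
            by (auto simp: A_def A'_def R_def)
          then show ?thesis
            using cRA X d_le d_ge by (simp add: card_Diff_subset)
        qed
        show "t \<le> card {x \<in> R - insert z (R - W - X). {b, x} \<notin> M}"
        proof -
          have "W \<union> (X - {z}) \<subseteq> {x \<in> R - insert z (R - W - X). {b, x} \<notin> M}"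
            using nb W(1) X(1) A'(3) z by (auto simp: R_def)
          then have "card (W \<union> (X - {z})) \<le> card {x \<in> R - insert z (R - W - X). {b, x} \<notin> M}"
            using finR by (intro card_mono) auto
          moreover have "card (W \<union> (X - {z})) = card W + card (X - {z})"
            using W X by (intro card_Un_disjoint) auto
          moreover have "card (X - {z}) = t + 2 - d"
            using X z by simp
          ultimately show ?thesis
            using W(2) d_le d_ge by simp
        qed
        show "card (M \<inter> Pow R) + card W \<le> 2 * t + 1"
          using cM W(2) Suc.prems(4) d_ge by simp
        show "card W \<le> t"
          using W(2) d_le by simp
        show "deg (M \<inter> Pow R) w \<le> t" if "w \<in> W" for w
          using that W(1) A'(3) by auto
        show "{b, y} \<notin> M" if "y \<in> insert z (R - W - X)" for y
          using that nb[of y] X(1) z by (auto simp: R_def)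
        show "{a, x} \<notin> M" if "x \<in> X" for x
          using that X(1) by (auto simp: A_def A'_def R_def)
      qed (use X(1) W(1) A'(3) z in \<open>auto simp: R_def\<close>)
    next
      case other
      \<comment> \<open>With \<open>d = t + 2\<close> the degree sum would be at least
        \<open>d + 2 * d + (2 * t + 3 - d) = 4 * t + 7\<close>, more than
        \<open>2 * card M\<close>.\<close>
      have d_le': "d \<le> t + 1"
      proof (rule ccontr)
        assume "\<not> d \<le> t + 1"
        then have d: "d = t + 2"
          using d_le by simp
        have "A \<subseteq> V - {a}"
          using A(3) by (auto simp: A_def)
        have "(\<Sum>x\<in>V. deg M x) = deg M a + (\<Sum>x\<in>V - {a}. deg M x)"
          using fV a(1) by (rule sum.remove)
        also have "(\<Sum>x\<in>V - {a}. deg M x) = (\<Sum>x\<in>V - {a} - A. deg M x) + (\<Sum>x\<in>A. deg M x)"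
          using fV \<open>A \<subseteq> V - {a}\<close> by (intro sum.subset_diff) auto
        finally have "2 * card M = d + ((\<Sum>x\<in>V - {a} - A. deg M x) + (\<Sum>x\<in>A. deg M x))"
          using handshake[OF fV M] by (simp add: d_def)
        moreover have "(\<Sum>x\<in>A. 2) \<le> (\<Sum>x\<in>A. deg M x)"
          using other(2) by (intro sum_mono) auto
        moreover have "(\<Sum>x\<in>V - {a} - A. 1) \<le> (\<Sum>x\<in>V - {a} - A. deg M x)"
          using other(1) by (intro sum_mono) auto
        moreover have "card (V - {a} - A) = 2 * t + 3 - d"
          using \<open>A \<subseteq> V - {a}\<close> A a(1) fV Suc.prems(3) by (simp add: card_Diff_subset)
        ultimately show False
          using d A(1) Suc.prems(4) by simp
      qed
      have "\<not> (\<forall>x\<in>V. 2 \<le> deg M x)"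
      proof
        assume "\<forall>x\<in>V. 2 \<le> deg M x"
        then have "(\<Sum>x\<in>V. 2) \<le> (\<Sum>x\<in>V. deg M x)"
          by (intro sum_mono) auto
        then show False
          using handshake[OF fV M] Suc.prems(3,4) by simp
      qed
      then obtain b where b: "b \<in> V" "deg M b = 1"
        using other(1) by (metis One_nat_def Suc_1 Suc_leI le_neq_implies_less)
      then have bA: "b \<notin> A" "b \<noteq> a"
        using other(2)[of b] d_ge by (auto simp: d_def)
      have abM: "{a, b} \<notin> M"
        using bA(1) b(1) by (simp add: A_def)
      have "card {y \<in> V. {b, y} \<in> M} = 1"
        using deg_eq_card_nbrs[OF M, of b] b(2) by simp
      then obtain c where c: "{y \<in> V. {b, y} \<in> M} = {c}"
        by (auto simp: card_1_singleton_iff)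
      have cb: "c \<noteq> b" "c \<noteq> a" "c \<in> V" "{b, c} \<in> M"
      proof -
        show cV: "c \<in> V" "{b, c} \<in> M"
          using c by blast+
        then show "c \<noteq> b" "c \<noteq> a"
          using M abM doubleton_in_pairs[of b c V] by (auto simp: insert_commute)
      qed
      have nb: "{b, x} \<notin> M" if "x \<in> V" "x \<noteq> c" for x
        using c that by blast
      define R where "R = V - {a} - {b}"
      then have RV: "R \<subseteq> V"
        by blast
      note cR = R(2)[OF b(1) bA(2), folded R_def]
      have AR: "A \<subseteq> R" and finR: "finite R" and cR': "c \<in> R"
        using A(3) bA fV cb by (auto simp: A_def R_def)
      have cM: "card (M \<inter> Pow R) + d + 1 = card M"
        using card_restrict2[OF fV M bA(2)[symmetric]] b(2) abM by (simp add: R_def d_def)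
      let ?full = "{x \<in> R. t + 1 \<le> deg (M \<inter> Pow R) x}"
      have c_full: "deg (M \<inter> Pow R) c \<le> t"
      proof -
        have "deg (M \<inter> Pow (V - {b})) c + 1 = deg M c"
          using deg_restrict[OF fV M, of b c] cb by simp
        moreover have "deg (M \<inter> Pow R) c \<le> deg (M \<inter> Pow (V - {b})) c"
          using finM by (intro deg_mono) (auto simp: R_def)
        ultimately show ?thesis
          using a(2)[OF cb(3)] d_le' by (simp add: d_def)
      qed
      have "card (A - {c}) \<ge> d - 1"
        using A diff_card_le_card_Diff[of "{c}" A] by simp
      moreover have "card ?full \<le> 1"
      proof (rule full(2))
        show "card (M \<inter> Pow R) \<le> 2 * t"
          using cM Suc.prems(4) d_ge by simp
      qed (rule RV)
      ultimately have "d - 2 = 0 \<or> d - 2 + card ?full \<le> card (A - {c})"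
        by linarith
      \<comment> \<open>The vertex \<open>c\<close> joins the set attached by \<open>F\<close>, so
        \<open>b\<close> never has to reach it. The pair \<open>{b, c}\<close> disappears too, which
        permits \<open>d - 1\<close> instead of \<open>d - 2\<close> attached vertices.\<close>
      then obtain W where W: "W \<subseteq> A - {c} - ?full" "card W = d - 2" "finite W"
        by (rule subset_avoiding[OF finite_Diff[OF A(2)] full(1)[OF RV]]) blast
      have cRA: "card (R - A) = 2 * t + 2 - d"
        using AR A cR by (simp add: card_Diff_subset)
      then have "t + 2 - d \<le> card (R - A - {c})"
        using diff_card_le_card_Diff[of "{c}" "R - A"] d_le' d_ge by simp
      then obtain X where X: "X \<subseteq> R - A - {c}" "card X = t + 2 - d" "finite X"
        by (rule obtain_subset_with_card_n)
      show ?thesis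
      proof (rule step[OF b(1) bA(2) R_def, of X "R - insert c W - X" "insert c W"])
        show "t \<le> card {x \<in> R - X. {a, x} \<notin> M}"
        proof -
          have "{x \<in> R - X. {a, x} \<notin> M} = (R - A) - X"
            by (auto simp: A_def R_def)
          moreover have "card ((R - A) - X) = card (R - A) - card X"
            using X by (intro card_Diff_subset) auto
          ultimately show ?thesis
            using cRA X(2) d_le d_ge by simp
        qed
        show "t \<le> card {x \<in> R - (R - insert c W - X). {b, x} \<notin> M}"
        proof -
          have "W \<union> X \<subseteq> {x \<in> R - (R - insert c W - X). {b, x} \<notin> M}"
            using nb W(1) X(1) AR by (auto simp: R_def)
          then have "card (W \<union> X) \<le> card {x \<in> R - (R - insert c W - X). {b, x} \<notin> M}"
            using finR by (intro card_mono) auto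
          moreover have "card (W \<union> X) = card W + card X"
            using W X by (intro card_Un_disjoint) auto
          ultimately show ?thesis
            using W(2) X(2) d_le d_ge by simp
        qed
        have cW: "card (insert c W) = d - 1"
          using W d_ge by (subst card_insert_disjoint) auto
        show "card (M \<inter> Pow R) + card (insert c W) \<le> 2 * t + 1"
          using cM cW Suc.prems(4) d_ge by simp
        show "card (insert c W) \<le> t"
          using cW d_le' by simp
        show "deg (M \<inter> Pow R) w \<le> t" if "w \<in> insert c W" for w
          using that W(1) AR c_full by auto
        show "{b, y} \<notin> M" if "y \<in> R - insert c W - X" for y
          using that nb[of y] by (auto simp: R_def)
        show "{a, x} \<notin> M" if "x \<in> X" for x
          using that X(1) by (auto simp: A_def R_def)
      qed (use X(1) W(1) AR cR' abM in auto)
    qed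
  qed
qed (simp add: pack_0)

text \<open>The bounds on \<open>M\<close> say \<open>card M < 2 * r\<close> and \<open>deg M x \<le> r\<close> for \<open>r = card V - 1 - t\<close>.\<close>

lemma pack_below_two_stars:
  assumes "finite V" "M \<subseteq> pairs V" "2 * t + 2 \<le> card V" "card M + 2 * t + 3 \<le> 2 * card V"
    "\<And>x. x \<in> V \<Longrightarrow> deg M x + t + 1 \<le> card V"
  shows "pack t V (pairs V - M)"
  using assms
proof (induction "card V" arbitrary: V M)
  case (Suc n)
  note fV = Suc.prems(1) and M = Suc.prems(2)
  consider "card V = 2 * t + 2" | "card M + t < card V" | "2 * t + 3 \<le> card V" "card V \<le> card M + t"
    using Suc.prems(3) by linarith
  then show ?case
  proof cases
    case 1
    then show ?thesis
      using Suc.prems by (intro pack_bounded_deg) auto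
  next
    case 2
    then show ?thesis
      using Suc.prems by (intro pack_few_missing) auto
  next
    case 3
    have "V \<noteq> {}"
      using Suc.hyps(2) by auto
    with fV obtain v where v: "v \<in> V" "\<And>x. x \<in> V \<Longrightarrow> deg M x \<le> deg M v"
      by (rule max_deg_vertex[where M = M]) blast
    \<comment> \<open>Degree two is required because the allowance \<open>2 * card V\<close> falls
      by two with each deleted vertex.\<close>
    have d_ge: "2 \<le> deg M v"
    proof (rule ccontr)
      assume "\<not> 2 \<le> deg M v"
      then have "deg M x \<le> 1" if "x \<in> V" for x
        using v(2)[OF that] by simp
      then have "2 * card M \<le> 1 * card V"
        by (rule twice_card_le[OF fV M])
      then show False
        using 3 by simp
    qed
    have cV: "card (V - {v}) = n"
      using v(1) Suc.hyps(2) fV by simp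
    have cM: "card (M \<inter> Pow (V - {v})) + deg M v = card M"
      by (rule card_restrict[OF fV M])
    have "pack t (V - {v}) (pairs (V - {v}) - M \<inter> Pow (V - {v}))"
    proof (rule Suc.hyps(1))
      show "deg (M \<inter> Pow (V - {v})) x + t + 1 \<le> card (V - {v})" if "x \<in> V - {v}" for x
      proof -
        have "deg (M \<inter> Pow (V - {v})) x < card V - 1 - t"
          using that v(2)[of x] Suc.prems(3,4) by (intro deg_restrict_max[OF fV M]) auto
        then show ?thesis
          using cV Suc.hyps(2) by simp
      qed
    qed (use cV cM d_ge Suc.hyps(2) Suc.prems(4) 3 fV restrict_pairs[OF M] in simp_all)
    then show ?thesis
      by (rule pack_remove[OF fV M v(1) Suc.prems(5)[OF v(1)]])
  qed
qed auto

text \<open>One missing pair more than in \<open>pack_below_two_stars\<close>, up to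
  \<open>2 * r\<close> with \<open>r = card V - 1 - t\<close>. At equality some vertex
  \<open>v\<close> has degree at least three, and its deletion brings the size back below the bound;
  a vertex still of degree \<open>r\<close> afterwards would form the excluded configuration with
  \<open>v\<close>.\<close>

lemma pack_no_two_stars:
  assumes fV: "finite V" and M: "M \<subseteq> pairs V"
    and V: "2 * t + 3 \<le> card V" "card M + 2 * t + 2 \<le> 2 * card V"
    and deg: "\<And>x. x \<in> V \<Longrightarrow> deg M x + t + 1 \<le> card V"
    and stars: "\<And>p q. p \<in> V \<Longrightarrow> q \<in> V \<Longrightarrow> p \<noteq> q \<Longrightarrow> {p, q} \<notin> M \<Longrightarrow>
        deg M p + t + 1 = card V \<Longrightarrow> deg M q + t + 1 = card V \<Longrightarrow> False"
  shows "pack t V (pairs V - M)"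
proof (cases "card M + 2 * t + 3 \<le> 2 * card V")
  case True
  then show ?thesis
    using assms by (intro pack_below_two_stars) auto
next
  case False
  then have cM: "card M + 2 * t + 2 = 2 * card V"
    using V(2) by simp
  have "V \<noteq> {}"
    using V(1) by auto
  with fV obtain v where v: "v \<in> V" "\<And>x. x \<in> V \<Longrightarrow> deg M x \<le> deg M v"
    by (rule max_deg_vertex[where M = M]) blast
  have d_ge: "3 \<le> deg M v"
  proof (rule ccontr)
    assume "\<not> 3 \<le> deg M v"
    then have "deg M x \<le> 2" if "x \<in> V" for x
      using v(2)[OF that] by simp
    then have "2 * card M \<le> 2 * card V"
      by (rule twice_card_le[OF fV M])
    then show False
      using cM V(1) by simp
  qed
  have cV: "card (V - {v}) + 1 = card V"
    using v(1) fV V(1) by simp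
  have cM': "card (M \<inter> Pow (V - {v})) + deg M v = card M"
    by (rule card_restrict[OF fV M])
  have "pack t (V - {v}) (pairs (V - {v}) - M \<inter> Pow (V - {v}))"
  proof (rule pack_below_two_stars)
    show "deg (M \<inter> Pow (V - {v})) x + t + 1 \<le> card (V - {v})" if x: "x \<in> V - {v}" for x
    proof (rule ccontr)
      assume *: "\<not> deg (M \<inter> Pow (V - {v})) x + t + 1 \<le> card (V - {v})"
      have "deg (M \<inter> Pow (V - {v})) x + (if {v, x} \<in> M then 1 else 0) = deg M x"
        using x by (intro deg_restrict[OF fV M]) auto
      then have "{v, x} \<notin> M" "deg M x + t + 1 = card V"
        using * cV deg[of x] x by (auto split: if_splits)
      moreover have "deg M v + t + 1 = card V"
        using calculation(2) v deg[of v] x by (metis DiffD1 add_le_mono1 le_antisym)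
      ultimately show False
        using stars[of v x] v(1) x by auto
    qed
  qed (use cV cM cM' d_ge V fV restrict_pairs[OF M] in simp_all)
  then show ?thesis
    by (rule pack_remove[OF fV M v(1) deg[OF v(1)]])
qed

text \<open>
  Two nonadjacent vertices \<open>v\<close>, \<open>w\<close> of \<open>M\<close>-degree \<open>card V - 1 - t\<close> that meet all of \<open>M\<close>:
  \<open>w\<close> is a leaf of all trees but one, which reaches \<open>w\<close> through \<open>v\<close>.
\<close>

lemma spack_two_stars:
  assumes fV: "finite V" and M: "M \<subseteq> pairs V" and vw: "v \<in> V" "w \<in> V" "v \<noteq> w" "{v, w} \<notin> M"
    and cov: "M \<inter> Pow (V - {v} - {w}) = {}"
    and deg: "deg M v + Suc t + 1 \<le> card V" "deg M w + Suc t + 1 \<le> card V"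
    and V: "1 \<le> t" "2 * Suc t + 2 \<le> card V"
  shows "spack (Suc t) V v (pairs V - M)"
proof -
  define R where "R = V - {v} - {w}"
  have finR: "finite R" and cR: "card R + 2 = card V"
    using fV vw V(2) by (auto simp: R_def)
  have R: "w \<notin> R" "v \<notin> R" "V - {v} = insert w R"
    using vw by (auto simp: R_def)
  have "pack (Suc t) R (pairs R)"
  proof (cases "card R = 2 * Suc t")
    case True
    then show ?thesis
      by (rule pack_complete_even[OF finR])
  next
    case False
    then have "pack (Suc t) R (pairs R - {})"
      using cR V finR by (intro pack_few_missing) auto
    then show ?thesis
      by simp
  qed
  then obtain f where "\<forall>i<Suc t. f i \<subseteq> pairs R \<and> conn R (f i)"
    "\<forall>i<Suc t. \<forall>j<Suc t. i \<noteq> j \<longrightarrow> f i \<inter> f j = {}"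
    unfolding pack_def by blast
  then have f: "f i \<subseteq> pairs R" "conn R (f i)" "j < Suc t \<Longrightarrow> i \<noteq> j \<Longrightarrow> f i \<inter> f j = {}"
    if "i < Suc t" for i j
    using that by simp_all
  have "pack t R (\<Union>i<t. f i)"
    unfolding pack_def using f by (intro exI[of _ f]) auto
  moreover define Q where "Q = {x \<in> R. {w, x} \<notin> M}"
  have "{x \<in> V - {w}. {w, x} \<notin> M} = insert v Q"
    using vw by (auto simp: Q_def R_def insert_commute)
  then have "card {x \<in> V - {w}. {w, x} \<notin> M} = Suc (card Q)"
    using R(2) finR by (auto simp: Q_def)
  then have cQ: "t \<le> card Q"
    using card_non_nbrs[OF fV M vw(2)] deg(2) by simp
  have fR: "w \<notin> e" "v \<notin> e" if "e \<in> f i" "i < Suc t" for e i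
    using f(1)[OF that(2)] that(1) R by (auto simp: pairs_def)
  have "pack t (insert w R) ((\<Union>i<t. f i) \<union> star w Q)"
    using cQ finR fR by (intro pack_leaf[OF calculation]) (auto simp: Q_def)
  then have p: "pack t (V - {v}) ((\<Union>i<t. f i) \<union> star w Q)"
    by (simp add: R(3))
  \<comment> \<open>At least \<open>t + 1\<close> edges at \<open>v\<close> are not missing, and
    \<open>1 \<le> t\<close>, so one of them leads into \<open>R\<close>.\<close>
  have "{x \<in> V - {v}. {v, x} \<notin> M} \<noteq> {w}"
    using card_non_nbrs[OF fV M vw(1)] deg(1) V by force
  then obtain z where z: "z \<in> R" "{v, z} \<notin> M"
    using vw by (auto simp: R_def)
  have "conn (insert v R) (insert {v, z} (f t))"
    using f(2) z(1) by (intro conn_leaf) simp_all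
  then have *: "conn (insert w (insert v R)) (insert {w, v} (insert {v, z} (f t)))"
    by (rule conn_leaf) simp
  have c: "conn V (insert {w, v} (insert {v, z} (f t)))"
  proof -
    have "insert w (insert v R) = V"
      using vw by (auto simp: R_def)
    then show "conn V (insert {w, v} (insert {v, z} (f t)))"
      using * by simp
  qed
  have "((\<Union>i<t. f i) \<union> star w Q) \<inter> insert {w, v} (insert {v, z} (f t)) = {}"
  proof -
    have "f i \<inter> f t = {}" if "i < t" for i
      using f(3)[of i t] that by simp
    moreover have "star w Q \<inter> f t = {}" "{w, v} \<notin> star w Q" "{v, z} \<notin> star w Q"
      using fR(1)[of _ t] z(1) R vw(3) by (auto simp: star_def Q_def doubleton_eq_iff)
    moreover have "{w, v} \<notin> f i" "{v, z} \<notin> f i" if "i < t" for i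
      using fR(2)[of _ i] that by auto
    ultimately show ?thesis
      by auto
  qed
  from spack_Suc[OF p c this]
  have "spack (Suc t) V v ((\<Union>i<t. f i) \<union> star w Q \<union> insert {w, v} (insert {v, z} (f t)))" .
  moreover have "f i \<subseteq> pairs V - M" if "i < Suc t" for i
  proof
    fix e assume "e \<in> f i"
    then have "e \<in> pairs R"
      using f(1)[OF that] by auto
    then show "e \<in> pairs V - M"
      using cov pairs_mono[of R V] by (auto simp: R_def pairs_def)
  qed
  moreover have "star w Q \<subseteq> pairs V - M" "{w, v} \<in> pairs V - M" "{v, z} \<in> pairs V - M"
    using vw z by (auto simp: star_def Q_def R_def doubleton_in_pairs insert_commute)
  ultimately show ?thesis
    by (elim spack_mono) (auto simp: less_Suc_eq)
qed

section \<open>Packings with an optional vertex\<close>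

lemma spack_restrict:
  assumes "pack t (V - {v}) (pairs (V - {v}) - M \<inter> Pow (V - {v}))"
  shows "spack t V v (pairs V - M)"
  using spack_mono[OF spack_pack[OF assms] restrict_subset[of "V - {v}" V M "{}", simplified]]
  by simp

lemma spack_complete:
  assumes "finite V" "card V = 2 * t + 1" "v \<in> V"
  shows "spack (Suc t) V v (pairs V)"
proof -
  have "pack t (V - {v}) (pairs (V - {v}))"
    using assms by (intro pack_complete_even) auto
  then have "spack (Suc t) V v (pairs V - {})"
    by (intro spack_hub[where Z = "V - {v}" and F = "{}"]) (use assms(3) in \<open>auto simp: attached_empty\<close>)
  then show ?thesis
    by simp
qed

lemma spack_uncovered:
  assumes fV: "finite V" and M: "M \<subseteq> pairs V" and v: "v \<in> V" "deg M v = 0"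
    and pack: "pack t (V - {v}) (pairs (V - {v}) - M \<inter> Pow (V - {v}))"
  shows "spack (Suc t) V v (pairs V - M)"
  using not_adj_if_deg_0[OF finite_missing[OF fV M] v(2)] pack
  by (intro spack_hub[OF v(1), where Z = "V - {v}" and F = "{}"]) (auto simp: attached_empty)

text \<open>A hub without missing edges leaves \<open>M\<close> unchanged on
  \<open>2 * t + 1\<close> vertices, exactly what \<open>pack_odd\<close> admits; its star is the
  additional tree.\<close>

lemma spack_even:
  assumes fV: "finite V" and M: "M \<subseteq> pairs V" and V: "card V = 2 * t + 2" "card M \<le> t"
  obtains v where "v \<in> V" "spack (Suc t) V v (pairs V - M)"
proof -
  obtain v where v: "v \<in> V" "deg M v = 0"
    using uncovered_vertex[OF fV M] V by auto
  have "pack t (V - {v}) (pairs (V - {v}) - M \<inter> Pow (V - {v}))"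
    using V v card_restrict[OF fV M, of v] fV restrict_pairs[OF M] by (intro pack_odd) auto
  then show ?thesis
    using that v spack_uncovered[OF fV M v] by blast
qed

text \<open>The hub \<open>v\<close> has maximum degree \<open>d\<close>. Its \<open>d\<close>
  missing pairs disappear and at most \<open>d\<close> come back as \<open>F\<close>, so the
  \<open>2 * t + 1\<close> pairs that \<open>pack_bounded_deg\<close> tolerates on the remaining
  \<open>2 * t + 2\<close> vertices are not exceeded.\<close>

lemma spack_odd:
  assumes fV: "finite V" and M: "M \<subseteq> pairs V" and V: "card V = 2 * t + 3" "card M \<le> 2 * t + 1"
  obtains v where "v \<in> V" "spack (Suc t) V v (pairs V - M)"
proof -
  have finM: "finite M"
    using fV M by (rule finite_missing)
  have "V \<noteq> {}"
    using V(1) by auto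
  with fV obtain v where v: "v \<in> V" "\<And>x. x \<in> V \<Longrightarrow> deg M x \<le> deg M v"
    by (rule max_deg_vertex[where M = M]) blast
  define U where "U = V - {v}"
  define N where "N = M \<inter> Pow U"
  define d where "d = deg M v"
  define Z where "Z = {x \<in> U. {v, x} \<notin> M}"
  define D where "D = U - Z"
  have finU: "finite U" and cU: "card U = 2 * t + 2"
    using fV v(1) V(1) by (simp_all add: U_def)
  have N: "N \<subseteq> pairs U" "finite N"
    using restrict_pairs[OF M] finM by (simp_all add: N_def)
  have cN: "card N + d = card M"
    using card_restrict[OF fV M, of v] by (simp add: N_def U_def d_def)
  have cZ: "card Z + d = 2 * t + 2"
    using card_non_nbrs[OF fV M v(1)] V(1) by (simp add: Z_def U_def d_def)
  have ZD: "finite Z" "finite D" "Z \<inter> D = {}" "Z \<union> D = U"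
    using finU by (auto simp: Z_def D_def)
  then have cD: "card D = d"
    using cZ cU card_Un_disjoint[OF ZD(1-3)] by simp
  have degN: "deg N x + (if {v, x} \<in> M then 1 else 0) = deg M x" if "x \<in> U" for x
    using deg_restrict[OF fV M, of v x] that by (auto simp: N_def U_def)
  have deg_le: "deg N x \<le> d" if "x \<in> U" for x
    using degN[OF that] v(2)[of x] that by (simp add: U_def d_def)
  have deg_le': "deg N x \<le> card N" for x
    by (rule deg_le_card[OF N(2)])
  obtain F where F: "F \<subseteq> pairs U - N" "card F \<le> d" "attached Z D F"
    "\<And>x. x \<in> U \<Longrightarrow> deg (N \<union> F) x \<le> t + 1"
  proof (cases "d \<le> t")
    case True
    show ?thesis
    proof (rule greedy_attach[OF ZD(2,1,3), of N "t + 1"])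
      show "card N + card D < 2 * (t + 1)"
        using cN cD V(2) by simp
      show "deg N x \<le> t + 1" if "x \<in> Z \<union> D" for x
        using deg_le[of x] that ZD(4) True by simp
      show "deg N w < t + 1 \<and> deg N w + 2 \<le> card Z" if "w \<in> D" for w
      proof -
        have "w \<in> U" "{v, w} \<in> M"
          using that by (auto simp: D_def Z_def)
        then have "deg N w + 1 \<le> d"
          using degN[of w] v(2)[of w] by (simp add: U_def d_def)
        then show ?thesis
          using True cZ by simp
      qed
    qed (use N that cD ZD(4) in auto)
  next
    case False
    \<comment> \<open>\<open>Z\<close> is one vertex too small for the greedy choice until a first vertex has been attached.\<close>
    then have "D \<noteq> {}"
      using cD by auto
    then obtain w where w: "w \<in> D" "w \<in> U"
      using ZD(4) by blast
    have "card {y \<in> U. {w, y} \<in> N} < card Z"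
      using deg_eq_card_nbrs[OF N(1), of w] deg_le'[of w] cN cZ V(2) by simp
    then have "\<not> Z \<subseteq> {y \<in> U. {w, y} \<in> N}"
      using finU by (metis (no_types, lifting) card_mono finite_Collect_conjI finite_subset linorder_not_less
          mem_Collect_eq subsetI)
    then obtain z where z: "z \<in> Z" "z \<in> U" "{w, z} \<notin> N"
      using ZD(4) by blast
    have wz: "w \<noteq> z"
      using w z ZD(3) by blast
    define N1 where "N1 = insert {w, z} N"
    have deg1: "deg N1 x = deg N x + (if x = w \<or> x = z then 1 else 0)" for x
      unfolding N1_def by (rule deg_insert[OF N(2) z(3)])
    have eq: "insert w Z \<union> (D - {w}) = U"
      using ZD(4) w(1) by blast
    have cN1: "card N1 = card N + 1"
      using N(2) z(3) by (simp add: N1_def)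
    have c1: "card (insert w Z) = card Z + 1" "card (D - {w}) + 1 = d"
    proof -
      have "w \<notin> Z"
        using w(1) ZD(3) by blast
      then show "card (insert w Z) = card Z + 1" "card (D - {w}) + 1 = d"
        using ZD(1,2) w(1) cD False by simp_all
    qed
    obtain F1 where F1: "F1 \<subseteq> pairs (insert w Z \<union> (D - {w})) - N1" "card F1 \<le> card (D - {w})"
      "attached (insert w Z) (D - {w}) F1"
      "\<And>x. x \<in> insert w Z \<union> (D - {w}) \<Longrightarrow> deg (N1 \<union> F1) x \<le> t + 1"
    proof (rule greedy_attach[of "D - {w}" "insert w Z" N1 "t + 1"])
      show "N1 \<subseteq> pairs (insert w Z \<union> (D - {w}))"
        using N(1) w z wz unfolding eq by (simp add: N1_def doubleton_in_pairs)
      show "card N1 + card (D - {w}) < 2 * (t + 1)"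
        using cN1 c1 cN V(2) by simp
      show "deg N1 x \<le> t + 1" for x
        using deg_le'[of x] cN V(2) False by (simp add: deg1)
      show "deg N1 x < t + 1 \<and> deg N1 x + 2 \<le> card (insert w Z)" if "x \<in> D - {w}" for x
      proof -
        have "x \<noteq> w" "x \<noteq> z"
          using that z(1) ZD(3) by auto
        then show ?thesis
          using deg_le'[of x] cN cZ V(2) False c1 by (simp add: deg1)
      qed
    qed (use ZD in auto)
    show ?thesis
    proof (rule that)
      show "insert {w, z} F1 \<subseteq> pairs U - N"
        using F1(1) w z wz unfolding eq by (auto simp: doubleton_in_pairs N1_def)
      show "card (insert {w, z} F1) \<le> d"
        using F1(2) c1(2) card_insert_le_m1[of d F1 "{w, z}"] False by simp
      have "z \<notin> insert w (D - {w})"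
        using z(1) ZD(3) wz by auto
      moreover have "attached (insert w Z) (D - {w}) (insert {w, z} F1)"
        using F1(3) unfolding attached_def by blast
      ultimately have "attached Z (insert w (D - {w})) (insert {w, z} F1)"
        by (intro attached_insert[OF z(1)]) simp_all
      then show "attached Z D (insert {w, z} F1)"
        using w(1) by (simp add: insert_absorb)
      show "deg (N \<union> insert {w, z} F1) x \<le> t + 1" if "x \<in> U" for x
        using F1(4)[of x] that unfolding eq by (simp add: N1_def)
    qed
  qed
  have "pack t U (pairs U - (N \<union> F))"
  proof (rule pack_bounded_deg[OF finU])
    show "card (N \<union> F) \<le> 2 * t + 1"
      using card_Un_le[of N F] F(2) cN V(2) by linarith
  qed (use F N cU in auto)
  moreover have "F \<subseteq> pairs U - M"
    using F(1) by (auto simp: N_def pairs_def)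
  ultimately have "spack (Suc t) V v (pairs V - M)"
    using F(3) by (intro spack_hub[OF v(1), of Z M F]) (auto simp: Z_def D_def U_def N_def)
  then show ?thesis
    using that v(1) by blast
qed

text \<open>All trees avoid a vertex \<open>v\<close> of maximum degree, unless some
  \<open>w\<close> keeps degree \<open>r = card V - 2 - t\<close> after its deletion. Then
  \<open>v\<close> has degree at least \<open>r\<close> as well, and
  \<open>card M \<le> 2 * r\<close> forces \<open>M\<close> to consist of two stars.\<close>

lemma spack_large:
  assumes fV: "finite V" and M: "M \<subseteq> pairs V" and t: "1 \<le> t" "2 * Suc t + 3 \<le> card V"
    and m: "card M + 2 * Suc t + 2 \<le> 2 * card V"
  obtains v where "v \<in> V" "spack (Suc t) V v (pairs V - M)"
proof -
  have "V \<noteq> {}"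
    using t(2) by auto
  with fV obtain v where v: "v \<in> V" "\<And>x. x \<in> V \<Longrightarrow> deg M x \<le> deg M v"
    by (rule max_deg_vertex[where M = M]) blast
  let ?N = "M \<inter> Pow (V - {v})"
  have cV: "card (V - {v}) + 1 = card V"
    using v(1) fV t(2) by simp
  have cN: "card ?N + deg M v = card M"
    by (rule card_restrict[OF fV M])
  have degN: "deg ?N x + (if {v, x} \<in> M then 1 else 0) = deg M x" if "x \<noteq> v" for x
    using deg_restrict[OF fV M, of v x] that by simp
  show ?thesis
  proof (cases "\<exists>w\<in>V - {v}. card V \<le> deg ?N w + Suc t + 1")
    case True
    then obtain w where w: "w \<in> V" "w \<noteq> v" "card V \<le> deg ?N w + Suc t + 1"
      by blast
    have dw: "deg ?N w + (if {v, w} \<in> M then 1 else 0) = deg M w" "deg M w \<le> deg M v"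
      using degN w v(2) by auto
    have "deg ?N w \<le> card ?N"
      using finite_missing[OF fV M] by (intro deg_le_card) simp
    then have vw: "{v, w} \<notin> M" "deg M v + Suc t + 1 = card V" "deg M w + Suc t + 1 = card V"
      using dw w(3) cN m by (auto split: if_splits)
    have "card (M \<inter> Pow (V - {v} - {w})) = 0"
      using card_restrict2[OF fV M w(2)[symmetric]] vw m by simp
    then have "M \<inter> Pow (V - {v} - {w}) = {}"
      using finite_missing[OF fV M] by simp
    then have "spack (Suc t) V v (pairs V - M)"
      using v(1) w vw t by (intro spack_two_stars[OF fV M]) auto
    then show ?thesis
      using that v(1) by blast
  next
    case False
    have "pack (Suc t) (V - {v}) (pairs (V - {v}) - ?N)"
    proof (rule pack_below_two_stars)
      show "card ?N + 2 * Suc t + 3 \<le> 2 * card (V - {v})"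
      proof (rule ccontr)
        assume *: "\<not> card ?N + 2 * Suc t + 3 \<le> 2 * card (V - {v})"
        then have *: "2 * card V \<le> card M + 2 * Suc t + 4 - deg M v" "deg M v \<le> card M" and "deg M v \<le> 2"
          using cN cV m by linarith+
        then consider "deg M v = 0" | "deg M v = 1" | "deg M v = 2"
          by linarith
        then show False
          by cases (use * twice_card_le[OF fV M v(2)] t(2) in simp_all)
      qed
      show "deg ?N x + Suc t + 1 \<le> card (V - {v})" if "x \<in> V - {v}" for x
        using False that cV by force
    qed (use fV cV t restrict_pairs[OF M] in auto)
    then have "spack (Suc t) V v (pairs V - M)"
      by (rule spack_restrict)
    then show ?thesis
      using that v(1) by blast
  qed
qed

text \<open>After deleting a vertex, \<open>2 * t + 3\<close> vertices remain, one too few for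
  \<open>pack_below_two_stars\<close> with \<open>Suc t\<close> trees. In the main case one tree
  therefore uses a hub \<open>u\<close> of minimum degree, and only \<open>t\<close> trees have to
  be found in \<open>V - {u}\<close>. The vertices that \<open>u\<close> misses all hang on one
  vertex \<open>z\<close>.\<close>

lemma spack_tight_even:
  assumes fV: "finite V" and M: "M \<subseteq> pairs V" and t: "4 \<le> t" "card V = 2 * t + 4"
    and m: "card M \<le> 2 * t + 4"
  obtains v where "v \<in> V" "spack (Suc t) V v (pairs V - M)"
proof -
  have finM: "finite M"
    using fV M by (rule finite_missing)
  have "V \<noteq> {}"
    using t(2) by auto
  with fV obtain v where v: "v \<in> V" "\<And>x. x \<in> V \<Longrightarrow> deg M x \<le> deg M v"
    by (rule max_deg_vertex[where M = M]) blast
  consider (high) "t + 3 \<le> deg M v"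
    | (stars) p q where "p \<in> V" "q \<in> V" "p \<noteq> q" "{p, q} \<notin> M" "deg M p = t + 2" "deg M q = t + 2"
    | (low) "deg M v \<le> t + 2"
        "\<And>p q. p \<in> V \<Longrightarrow> q \<in> V \<Longrightarrow> p \<noteq> q \<Longrightarrow> {p, q} \<notin> M \<Longrightarrow> deg M p = t + 2 \<Longrightarrow> deg M q = t + 2 \<Longrightarrow> False"
    by fastforce
  then show ?thesis
  proof cases
    case high
    have "pack (Suc t) (V - {v}) (pairs (V - {v}) - M \<inter> Pow (V - {v}))"
      using high card_restrict[OF fV M, of v] fV v(1) t m restrict_pairs[OF M]
      by (intro pack_few_missing) auto
    then have "spack (Suc t) V v (pairs V - M)"
      by (rule spack_restrict)
    then show ?thesis
      using that v(1) by blast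
  next
    case stars
    have "card (M \<inter> Pow (V - {p} - {q})) = 0"
      using card_restrict2[OF fV M stars(3)] stars m by simp
    then have "M \<inter> Pow (V - {p} - {q}) = {}"
      using finM by simp
    then have "spack (Suc t) V p (pairs V - M)"
      using stars t by (intro spack_two_stars[OF fV M]) auto
    then show ?thesis
      using that stars(1) by blast
  next
    case low
    have deg_le: "deg M x \<le> t + 2" if "x \<in> V" for x
      using v(2)[OF that] low(1) by simp
    from fV \<open>V \<noteq> {}\<close> obtain u where u: "u \<in> V" "\<And>x. x \<in> V \<Longrightarrow> deg M u \<le> deg M x"
      by (rule min_deg_vertex[where M = M]) blast
    define c where "c = deg M u"
    define U where "U = V - {u}"
    define D where "D = {x \<in> V. {u, x} \<in> M}"
    define N where "N = M \<inter> Pow U"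
    have cD: "card D = c"
      using deg_eq_card_nbrs[OF M, of u] by (simp add: c_def D_def)
    have D: "D \<subseteq> U" "finite D"
      using subsetD[OF M, of "{u, u}"] doubleton_in_pairs[of u u V] fV by (auto simp: D_def U_def)
    have sum_deg: "(\<Sum>x\<in>Q. deg M x) \<le> 4 * t + 8" if "Q \<subseteq> V" for Q
      using sum_mono2[OF fV that, of "deg M"] handshake[OF fV M] m by simp
    have "card V * c \<le> (\<Sum>x\<in>V. deg M x)"
      using sum_mono[of V "\<lambda>_. c" "deg M"] u(2) by (simp add: c_def)
    then have c_le: "(2 * t + 4) * c \<le> (2 * t + 4) * 2"
      using sum_deg[of V] t by simp
    then have c_le: "c \<le> 2"
      by (subst (asm) mult_le_cancel1) simp
    \<comment> \<open>Each vertex of \<open>D\<close> exchanges its pair with \<open>u\<close> for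
      one with \<open>z\<close>, so only \<open>z\<close> gains degree, namely \<open>c\<close>.
      Staying at most \<open>t + 1\<close>, it cannot become the centre of a star of size
      \<open>t + 2\<close>, and no new pair of stars arises.\<close>
    obtain z where z: "z \<in> U" "z \<notin> D" "\<And>w. w \<in> D \<Longrightarrow> {w, z} \<notin> M" "deg M z + c \<le> t + 1"
    proof (cases "c = 2")
      case False
      define Q where "Q = (if c = 0 then U else {x \<in> U - D. \<forall>w\<in>D. {w, x} \<notin> M})"
      have cQ: "t + 1 \<le> card Q"
      proof (cases "c = 0")
        case True
        then show ?thesis
          using fV u(1) t by (simp add: Q_def U_def)
      next
        case c: False
        then have "card D = 1"
          using cD c_le False by simp
        then obtain w where w: "D = {w}"
          by (auto simp: card_1_singleton_iff)
        have "w \<in> V" "{w, u} \<in> M"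
          using w by (auto simp: D_def insert_commute)
        then have "Q = {x \<in> V - {w}. {w, x} \<notin> M}"
          using c w by (auto simp: Q_def U_def)
        then show ?thesis
          using card_non_nbrs[OF fV M \<open>w \<in> V\<close>] deg_le[OF \<open>w \<in> V\<close>] t by simp
      qed
      have QV: "Q \<subseteq> V"
        by (auto simp: Q_def U_def)
      have "\<not> (\<forall>z\<in>Q. t + 1 \<le> deg M z)"
      proof
        assume "\<forall>z\<in>Q. t + 1 \<le> deg M z"
        then have "card Q * (t + 1) \<le> (\<Sum>z\<in>Q. deg M z)"
          using sum_mono[of Q "\<lambda>_. t + 1" "deg M"] by simp
        then have "card Q * (t + 1) \<le> 4 * t + 8"
          using sum_deg[OF QV] by simp
        moreover have "(t + 1) * (t + 1) \<le> card Q * (t + 1)"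
          using cQ by (intro mult_right_mono) auto
        \<comment> \<open>Here \<open>n \<ge> 12\<close> is decisive: for
          \<open>n = 2 * t + 4\<close> it says \<open>4 \<le> t\<close>, and four is the least value
          for which the inequality holds.\<close>
        moreover have "4 * t + 8 < (t + 1) * (t + 1)"
        proof -
          have "4 * t \<le> t * t" "(t + 1) * (t + 1) = t * t + 2 * t + 1"
            using t(1) by (auto simp: algebra_simps)
          then show ?thesis
            using t(1) by linarith
        qed
        ultimately show False
          by linarith
      qed
      then obtain z where "z \<in> Q" "deg M z + c \<le> t + 1"
        using c_le False by force
      moreover have "z \<in> U \<and> z \<notin> D \<and> (\<forall>w\<in>D. {w, z} \<notin> M)"
        using calculation(1) cD D by (auto simp: Q_def split: if_splits)
      ultimately show ?thesis
        using that by blast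
    next
      case True
      \<comment> \<open>Minimum degree two meets a degree sum of at most
        \<open>4 * t + 8 = 2 * card V\<close>.\<close>
      have deg2: "deg M x = 2" if "x \<in> V" for x
      proof -
        have "(\<Sum>x\<in>V. deg M x) = deg M x + (\<Sum>x\<in>V - {x}. deg M x)"
          using fV that by (rule sum.remove)
        moreover have "card (V - {x}) * 2 \<le> (\<Sum>x\<in>V - {x}. deg M x)"
          using sum_mono[of "V - {x}" "\<lambda>_. 2" "deg M"] u(2) True by (simp add: c_def)
        ultimately show ?thesis
          using sum_deg[of V] t(2) u(2)[OF that] True fV that by (simp add: c_def)
      qed
      \<comment> \<open>The ball of radius two around \<open>u\<close> in \<open>M\<close> has at
        most \<open>1 + 2 * 3\<close> vertices, so some vertex lies outside.\<close>
      let ?B = "insert u (\<Union>w\<in>D. insert w {x \<in> V. {w, x} \<in> M})"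
      have "card (insert w {x \<in> V. {w, x} \<in> M}) \<le> 3" if "w \<in> D" for w
        using deg_eq_card_nbrs[OF M, of w] deg2[of w] that fV by (auto simp: D_def card_insert_if)
      then have "(\<Sum>w\<in>D. card (insert w {x \<in> V. {w, x} \<in> M})) \<le> (\<Sum>w\<in>D. 3)"
        by (rule sum_mono)
      then have "card (\<Union>w\<in>D. insert w {x \<in> V. {w, x} \<in> M}) \<le> 6"
        using card_UN_le[OF D(2), of "\<lambda>w. insert w {x \<in> V. {w, x} \<in> M}"] cD True by simp
      moreover have finB: "finite ?B"
        using D(2) fV by auto
      ultimately have "card ?B < card V"
        using t card_insert_le_m1[of 7 "\<Union>w\<in>D. insert w {x \<in> V. {w, x} \<in> M}" u] by simp
      then have "\<not> V \<subseteq> ?B"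
        using card_mono[OF finB] by (meson linorder_not_less)
      then obtain z where z: "z \<in> V" "z \<notin> ?B"
        by blast
      then show ?thesis
        using deg2[OF z(1)] True t(1) by (intro that[of z]) (auto simp: U_def)
    qed
    define F where "F = (\<lambda>w. {w, z}) ` D"
    have finF: "finite F" and cF: "card F \<le> c"
      using D(2) card_image_le[OF D(2), of "\<lambda>w. {w, z}"] cD by (simp_all add: F_def)
    have finN: "finite N"
      using finM by (simp add: N_def)
    have F: "F \<subseteq> pairs U - M"
      using z D(1) by (auto simp: F_def doubleton_in_pairs)
    have degN: "deg N x + (if x \<in> D then 1 else 0) = deg M x" if "x \<in> U" for x
      using deg_restrict[OF fV M, of u x] that by (auto simp: N_def U_def D_def)
    have degz: "deg (N \<union> F) z \<le> t + 1"
      using deg_Un_le[OF finN finF, of z] degN[OF z(1)] deg_le_card[OF finF, of z] cF z(4) by linarith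
    have degx: "deg (N \<union> F) x \<le> deg M x" if "x \<in> U" "x \<noteq> z" for x
    proof -
      have "{e \<in> F. x \<in> e} = (if x \<in> D then {{x, z}} else {})"
        using that(2) by (auto simp: F_def)
      then have "deg F x = (if x \<in> D then 1 else 0)"
        by (simp add: deg_def)
      then show ?thesis
        using deg_Un_le[OF finN finF, of x] degN[OF that(1)] by linarith
    qed
    have cU: "card U = 2 * t + 3"
      using fV u(1) t(2) by (simp add: U_def)
    have "pack t U (pairs U - (N \<union> F))"
    proof (rule pack_no_two_stars)
      show "N \<union> F \<subseteq> pairs U"
        using F restrict_pairs[OF M] by (auto simp: N_def)
      have "card N + c = card M"
        using card_restrict[OF fV M, of u] by (simp add: N_def U_def c_def)
      then show "card (N \<union> F) + 2 * t + 2 \<le> 2 * card U"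
        using card_Un_le[of N F] cF m cU by linarith
      show "deg (N \<union> F) x + t + 1 \<le> card U" if "x \<in> U" for x
        using degx[OF that] deg_le[of x] degz that cU by (cases "x = z") (auto simp: U_def)
      show False if pq: "p \<in> U" "q \<in> U" "p \<noteq> q" "{p, q} \<notin> N \<union> F"
        "deg (N \<union> F) p + t + 1 = card U" "deg (N \<union> F) q + t + 1 = card U" for p q
      proof -
        have "p \<noteq> z" "q \<noteq> z"
          using pq(5,6) degz cU by auto
        then have "deg M p = t + 2" "deg M q = t + 2"
          using degx[OF pq(1)] degx[OF pq(2)] pq(5,6) cU deg_le[of p] deg_le[of q] pq(1,2)
          by (auto simp: U_def)
        moreover have "{p, q} \<notin> M"
          using pq by (auto simp: N_def)
        ultimately show False
          using low(2)[of p q] pq(1-3) by (auto simp: U_def)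
      qed
    qed (use fV cU in \<open>auto simp: U_def\<close>)
    moreover have "attached (U - D) D F"
      by (rule attached_common[of z]) (use z in \<open>auto simp: F_def\<close>)
    moreover have "U - (U - D) = D"
      using D(1) by blast
    ultimately have "spack (Suc t) V u (pairs V - M)"
      using F by (intro spack_hub[OF u(1), of "U - D" M F]) (auto simp: U_def N_def D_def)
    then show ?thesis
      using that u(1) by blast
  qed
qed

section \<open>Trees connecting a set\<close>

lemma list_crossing:
  assumes "p \<noteq> []" "Q (hd p)" "\<not> Q (last p)"
  shows "\<exists>i. Suc i < length p \<and> Q (p ! i) \<and> \<not> Q (p ! Suc i)"
  using assms
proof (induction p)
  case (Cons x p)
  show ?case
  proof (cases "p \<noteq> [] \<and> Q (hd p)")
    case True
    then obtain i where "Suc i < length p \<and> Q (p ! i) \<and> \<not> Q (p ! Suc i)"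
      using Cons by auto
    then show ?thesis
      by (intro exI[of _ "Suc i"]) simp
  next
    case False
    then show ?thesis
      using Cons.prems by (intro exI[of _ 0]) (auto simp: hd_conv_nth split: if_splits)
  qed
qed simp

lemma walk_crossing:
  assumes "walk_in G p" "Q (hd p)" "\<not> Q (last p)"
  obtains i where "Suc i < length p" "Q (p ! i)" "\<not> Q (p ! Suc i)"
    "{p ! i, p ! Suc i} \<in> eset G" "p ! i \<in> vset G" "p ! Suc i \<in> vset G"
proof -
  obtain i where i: "Suc i < length p" "Q (p ! i)" "\<not> Q (p ! Suc i)"
    using list_crossing[of p Q] assms by (auto simp: walk_in_def)
  moreover have "{p ! i, p ! Suc i} \<in> eset G"
    using assms(1) i(1) by (auto simp: walk_in_def successively_conv_nth)
  moreover have "p ! i \<in> vset G" "p ! Suc i \<in> vset G"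
    using assms(1) i(1) nth_mem[of i p] nth_mem[of "Suc i" p] by (auto simp: walk_in_def)
  ultimately show ?thesis
    using that by blast
qed

lemma conn_if_connected_ugraph:
  assumes "connected_ugraph G"
  shows "conn (vset G) (eset G)"
  unfolding conn_def
proof (intro allI impI)
  fix P assume P: "P \<subseteq> vset G \<and> P \<noteq> {} \<and> P \<noteq> vset G"
  then obtain u v where "u \<in> P" "v \<in> vset G" "v \<notin> P"
    by blast
  then obtain p where p: "walk_in G p" "hd p = u" "last p = v"
    using assms P unfolding connected_ugraph_def by blast
  obtain i where "p ! i \<in> P" "p ! Suc i \<notin> P" "{p ! i, p ! Suc i} \<in> eset G" "p ! Suc i \<in> vset G"
    by (rule walk_crossing[OF p(1), of "\<lambda>x. x \<in> P"]) (use p \<open>u \<in> P\<close> \<open>v \<notin> P\<close> in auto)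
  then show "\<exists>x\<in>P. \<exists>y\<in>vset G - P. {x, y} \<in> eset G"
    by blast
qed

lemma connected_ugraph_if_conn:
  assumes "conn U T" "U \<noteq> {}"
  shows "connected_ugraph (U, T)"
  unfolding connected_ugraph_def
proof (intro conjI ballI)
  fix u v assume uv: "u \<in> vset (U, T)" "v \<in> vset (U, T)"
  define P where "P = {x. \<exists>p. walk_in (U, T) p \<and> hd p = u \<and> last p = x}"
  have "walk_in (U, T) [u]"
    using uv by (simp add: walk_in_def)
  then have "u \<in> P"
    unfolding P_def by (intro CollectI exI[of _ "[u]"]) simp
  have "P \<subseteq> U"
    by (auto simp: P_def walk_in_def)
  have "P = U"
  proof (rule ccontr)
    assume "P \<noteq> U"
    with \<open>P \<subseteq> U\<close> \<open>u \<in> P\<close> obtain x y where xy: "x \<in> P" "y \<in> U - P" "{x, y} \<in> T"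
      using connD[OF assms(1), of P] by blast
    then obtain p where p: "walk_in (U, T) p" "hd p = u" "last p = x"
      by (auto simp: P_def)
    then have "walk_in (U, T) (p @ [y])" "hd (p @ [y]) = u" "last (p @ [y]) = y"
      using xy by (auto simp: walk_in_def successively_append_iff)
    then have "y \<in> P"
      unfolding P_def by blast
    then show False
      using xy by simp
  qed
  then show "\<exists>p. walk_in (U, T) p \<and> hd p = u \<and> last p = v"
    using uv by (auto simp: P_def)
qed (use assms in simp)

text \<open>Without the closing edge of a cycle every cut is still crossed: if the cut separates the
  ends of that edge, then the rest of the cycle crosses it elsewhere. As a cycle has at least three
  distinct vertices, none of its other edges equals the closing one.\<close>

lemma minimal_conn_acyclic:
  assumes T: "conn U T" and min: "\<And>e. e \<in> T \<Longrightarrow> \<not> conn U (T - {e})"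
  shows "\<not> cycle_in (U, T) p"
proof
  assume "cycle_in (U, T) p"
  then have p: "3 \<le> length p" "distinct p" "walk_in (U, T) p" "{last p, hd p} \<in> T"
    by (auto simp: cycle_in_def)
  define e where "e = {last p, hd p}"
  have "p \<noteq> []"
    using p(1) by auto
  then have ends: "last p = p ! (length p - 1)" "hd p = p ! 0"
    by (simp_all add: last_conv_nth hd_conv_nth)
  have neq: "{p ! i, p ! Suc i} \<noteq> e" if "Suc i < length p" for i
  proof
    assume "{p ! i, p ! Suc i} = e"
    then have "p ! i = p ! 0 \<and> p ! Suc i = p ! (length p - 1) \<or> p ! i = p ! (length p - 1)"
      unfolding e_def ends doubleton_eq_iff by argo
    moreover have "p ! i = p ! 0 \<longleftrightarrow> i = 0"
      using that by (intro nth_eq_iff_index_eq[OF p(2)]) linarith+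
    moreover have "p ! Suc i = p ! (length p - 1) \<longleftrightarrow> Suc i = length p - 1"
      using that by (intro nth_eq_iff_index_eq[OF p(2)]) linarith+
    moreover have "p ! i = p ! (length p - 1) \<longleftrightarrow> i = length p - 1"
      using that by (intro nth_eq_iff_index_eq[OF p(2)]) linarith+
    ultimately have "i = 0 \<and> Suc i = length p - 1 \<or> i = length p - 1"
      by argo
    then show False
      using p(1) that by linarith
  qed
  have cross: "\<exists>i. Q (p ! i) \<and> \<not> Q (p ! Suc i) \<and> {p ! i, p ! Suc i} \<in> T - {e} \<and> p ! i \<in> U \<and> p ! Suc i \<in> U"
    if Q: "Q (hd p)" "\<not> Q (last p)" for Q
  proof -
    obtain i where "Suc i < length p" "Q (p ! i)" "\<not> Q (p ! Suc i)" "{p ! i, p ! Suc i} \<in> T"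
      "p ! i \<in> U" "p ! Suc i \<in> U"
      by (rule walk_crossing[OF p(3), of Q]) (use Q in simp_all)
    then show ?thesis
      using neq by blast
  qed
  have "conn U (T - {e})"
    unfolding conn_def
  proof (intro allI impI)
    fix P assume "P \<subseteq> U \<and> P \<noteq> {} \<and> P \<noteq> U"
    then obtain x y where xy: "x \<in> P" "y \<in> U - P" "{x, y} \<in> T"
      using connD[OF T] by metis
    show "\<exists>x\<in>P. \<exists>y\<in>U - P. {x, y} \<in> T - {e}"
    proof (cases "{x, y} = e")
      case False
      then show ?thesis
        using xy by blast
    next
      case True
      then consider "hd p \<in> P" "last p \<notin> P" | "hd p \<notin> P" "last p \<in> P"
        using xy by (auto simp: e_def doubleton_eq_iff)
      then show ?thesis
      proof cases
        case 1
        then show ?thesis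
          using cross[of "\<lambda>x. x \<in> P"] by blast
      next
        case 2
        then show ?thesis
          using cross[of "\<lambda>x. x \<notin> P"] by (auto simp: insert_commute)
      qed
    qed
  qed
  then show False
    using min p(4) by (simp add: e_def)
qed

lemma tree_of_conn:
  assumes "finite U" "U \<noteq> {}" "conn U E" "E \<subseteq> pairs V"
  obtains T where "T \<subseteq> E" "tree_ugraph (U, T)" "conn U T"
proof -
  \<comment> \<open>Edges leaving \<open>U\<close> are harmless for \<open>conn\<close> but not
    allowed in a tree on \<open>U\<close>, hence the intersection with \<open>Pow U\<close>.\<close>
  let ?C = "\<lambda>T. T \<subseteq> E \<inter> Pow U \<and> conn U T"
  have "?C (E \<inter> Pow U)"
    using conn_restrict[OF assms(3)] by simp
  from ex_has_least_nat[of ?C, OF this, of card]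
  obtain T where "?C T \<and> (\<forall>T'. ?C T' \<longrightarrow> card T \<le> card T')" ..
  then have T: "?C T" "\<And>T'. ?C T' \<Longrightarrow> card T \<le> card T'"
    by simp_all
  have TU: "T \<subseteq> pairs U"
    using T(1) assms(4) by (auto simp: pairs_def)
  have finT: "finite T"
    using finite_missing[OF assms(1) TU] .
  have "\<not> conn U (T - {e})" if "e \<in> T" for e
  proof
    assume "conn U (T - {e})"
    then have "card T \<le> card (T - {e})"
      using T(1) by (intro T(2)) auto
    then show False
      using that finT card_Diff1_less[of T e] by simp
  qed
  then have "\<not> cycle_in (U, T) p" for p
    using T(1) minimal_conn_acyclic by blast
  moreover have "connected_ugraph (U, T)"
    using T(1) assms(2) by (intro connected_ugraph_if_conn) simp_all
  moreover have "simple_ugraph (U, T)"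
    using assms(1) TU by (auto simp: simple_ugraph_def pairs_def)
  ultimately show ?thesis
    using that[of T] T(1) by (auto simp: tree_ugraph_def)
qed

text \<open>A vertex set is grown across cuts, and each new vertex brings a new edge inside the
  set.\<close>

lemma conn_card_le:
  assumes "conn V E" "finite V" "finite E"
  shows "card V \<le> card E + 1"
proof -
  have "\<exists>P. P \<subseteq> V \<and> card P = k \<and> k \<le> card {e \<in> E. e \<subseteq> P} + 1" if "k \<le> card V" for k
    using that
  proof (induction k)
    case 0
    show ?case
      by (intro exI[of _ "{}"]) simp
  next
    case (Suc k)
    then obtain P where P: "P \<subseteq> V" "card P = k" "k \<le> card {e \<in> E. e \<subseteq> P} + 1"
      by auto
    have finP: "finite P"
      using P(1) assms(2) by (rule finite_subset)
    show ?case
    proof (cases "P = {}")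
      case True
      then have k: "k = 0"
        using P(2) by simp
      then obtain v where "v \<in> V"
        using Suc.prems by fastforce
      then show ?thesis
        using k by (intro exI[of _ "{v}"]) simp
    next
      case False
      have "P \<noteq> V"
        using P(2) Suc.prems by auto
      then obtain x y where xy: "x \<in> P" "y \<in> V - P" "{x, y} \<in> E"
        using connD[OF assms(1) P(1) False] by metis
      have "insert {x, y} {e \<in> E. e \<subseteq> P} \<subseteq> {e \<in> E. e \<subseteq> insert y P}"
        using xy by auto
      then have "card (insert {x, y} {e \<in> E. e \<subseteq> P}) \<le> card {e \<in> E. e \<subseteq> insert y P}"
        using assms(3) by (intro card_mono) auto
      moreover have "card (insert {x, y} {e \<in> E. e \<subseteq> P}) = Suc (card {e \<in> E. e \<subseteq> P})"
        using assms(3) xy by (intro card_insert_disjoint) auto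
      ultimately show ?thesis
        using P xy finP by (intro exI[of _ "insert y P"]) auto
    qed
  qed
  from this[of "card V"] obtain P where "card V \<le> card {e \<in> E. e \<subseteq> P} + 1"
    by auto
  also have "card {e \<in> E. e \<subseteq> P} \<le> card E"
    using assms(3) by (intro card_mono) auto
  finally show ?thesis
    by simp
qed

section \<open>Bounds for \<open>tree_conn\<close> and \<open>max_tree_conn\<close>\<close>

lemma simple_ugraph_iff: "simple_ugraph G \<longleftrightarrow> finite (vset G) \<and> eset G \<subseteq> pairs (vset G)"
  by (auto simp: simple_ugraph_def pairs_def)

lemma tree_conn_le:
  assumes "\<And>\<T>. edge_disjoint_trees G S \<T> \<Longrightarrow> card \<T> \<le> l"
  shows "tree_conn G S \<le> l"
proof -
  have "{card \<T> | \<T>. edge_disjoint_trees G S \<T>} \<subseteq> {..l}"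
    using assms by auto
  moreover have "edge_disjoint_trees G S {}"
    by (simp add: edge_disjoint_trees_def)
  then have "{card \<T> | \<T>. edge_disjoint_trees G S \<T>} \<noteq> {}"
    by blast
  ultimately show ?thesis
    unfolding tree_conn_def by (subst Max_le_iff) (auto intro: finite_subset)
qed

lemma edge_disjoint_trees_subset:
  assumes "edge_disjoint_trees G S \<T>"
  shows "\<T> \<subseteq> Pow (vset G) \<times> Pow (eset G)"
proof
  fix T assume "T \<in> \<T>"
  then have "vset T \<subseteq> vset G" "eset T \<subseteq> eset G"
    using assms by (auto simp: edge_disjoint_trees_def tree_connecting_def sub_ugraph_def)
  then show "T \<in> Pow (vset G) \<times> Pow (eset G)"
    by (simp add: mem_Times_iff)
qed

lemma finite_subgraphs: "simple_ugraph G \<Longrightarrow> finite (Pow (vset G) \<times> Pow (eset G))"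
  using finite_missing[of "vset G" "eset G"] by (simp add: simple_ugraph_iff)

lemma le_tree_conn:
  assumes "simple_ugraph G" "edge_disjoint_trees G S \<T>"
  shows "card \<T> \<le> tree_conn G S"
proof -
  have "{card \<T> | \<T>. edge_disjoint_trees G S \<T>} \<subseteq> {..card (Pow (vset G) \<times> Pow (eset G))}"
    using card_mono[OF finite_subgraphs[OF assms(1)] edge_disjoint_trees_subset] by auto
  then have "finite {card \<T> | \<T>. edge_disjoint_trees G S \<T>}"
    by (rule finite_subset) simp
  then show ?thesis
    unfolding tree_conn_def using assms(2) by (intro Max_ge) auto
qed

lemma finite_tree_conns: "finite (vset G) \<Longrightarrow> finite {tree_conn G S | S. S \<subseteq> vset G \<and> card S = k}"
  by (rule finite_subset[of _ "tree_conn G ` Pow (vset G)"]) auto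

lemma tree_conn_le_max:
  assumes "simple_ugraph G" "S \<subseteq> vset G"
  shows "tree_conn G S \<le> max_tree_conn (card S) G"
  unfolding max_tree_conn_def
  using assms finite_tree_conns[of G] by (intro Max_ge) (auto simp: simple_ugraph_def)

lemma max_tree_conn_le:
  assumes "simple_ugraph G" "card (vset G) = Suc k"
    and "\<And>v \<T>. v \<in> vset G \<Longrightarrow> edge_disjoint_trees G (vset G - {v}) \<T> \<Longrightarrow> card \<T> \<le> l"
  shows "max_tree_conn k G \<le> l"
proof -
  have fin: "finite (vset G)"
    using assms(1) by (simp add: simple_ugraph_def)
  have le: "tree_conn G S \<le> l" if S: "S \<subseteq> vset G" "card S = k" for S
  proof -
    have "card (vset G - S) = 1"
      using fin S assms(2) by (simp add: card_Diff_subset finite_subset)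
    then obtain v where v: "vset G - S = {v}"
      by (auto simp: card_1_singleton_iff)
    then have "S = vset G - {v}" "v \<in> vset G"
      using S(1) by auto
    then show ?thesis
      using assms(3) by (auto intro: tree_conn_le)
  qed
  obtain S where "S \<subseteq> vset G" "card S = k"
    using obtain_subset_with_card_n[of k "vset G"] assms(2) by auto
  then have "{tree_conn G S | S. S \<subseteq> vset G \<and> card S = k} \<noteq> {}"
    by blast
  then show ?thesis
    unfolding max_tree_conn_def using le finite_tree_conns[OF fin]
    by (subst Max_le_iff) auto
qed

text \<open>With at least three vertices in the graph every tree has an edge, so disjoint edge sets
  give distinct trees and the set of trees really has \<open>t\<close> elements.\<close>

lemma spack_imp_tree_conn:
  assumes G: "simple_ugraph G" and V: "3 \<le> card (vset G)" and v: "v \<in> vset G"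
    and pack: "spack t (vset G) v (eset G)"
  shows "t \<le> tree_conn G (vset G - {v})"
proof -
  let ?V = "vset G" and ?E = "eset G"
  have fin: "finite ?V" and E: "?E \<subseteq> pairs ?V"
    using G by (auto simp: simple_ugraph_iff)
  obtain f where f: "\<forall>i<t. f i \<subseteq> ?E \<and> (conn ?V (f i) \<or> conn (?V - {v}) (f i))"
    "\<forall>i<t. \<forall>j<t. i \<noteq> j \<longrightarrow> f i \<inter> f j = {}"
    using pack unfolding spack_def by blast
  have "\<exists>T. tree_connecting G (?V - {v}) T \<and> eset T \<subseteq> f i \<and> eset T \<noteq> {}" if "i < t" for i
  proof -
    obtain U where U: "?V - {v} \<subseteq> U" "U \<subseteq> ?V" "conn U (f i)"
    proof -
      have "conn ?V (f i) \<or> conn (?V - {v}) (f i)"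
        using f(1) \<open>i < t\<close> by simp
      then show ?thesis
        using that[of ?V] that[of "?V - {v}"] by auto
    qed
    have "card (?V - {v}) = card ?V - 1"
      using v fin by simp
    then have cU: "2 \<le> card U"
      using card_mono[OF finite_subset[OF U(2) fin] U(1)] V by simp
    have finU: "finite U"
      using U(2) fin by (rule finite_subset)
    have "f i \<subseteq> pairs ?V"
      using f(1) that E by blast
    then obtain T where T: "T \<subseteq> f i" "tree_ugraph (U, T)" "conn U T"
      using tree_of_conn[OF finU _ U(3)] cU by (metis card.empty not_numeral_le_zero)
    have "T \<noteq> {}"
    proof
      assume "T = {}"
      then have "card U \<le> 1"
        using conn_card_le[OF T(3) finU] by simp
      then show False
        using cU by simp
    qed
    then show ?thesis
      using T U f(1) \<open>i < t\<close> subset_trans[of T "f i" ?E]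
      by (intro exI[of _ "(U, T)"]) (simp add: tree_connecting_def sub_ugraph_def tree_ugraph_def)
  qed
  then obtain T where T: "\<And>i. i < t \<Longrightarrow> tree_connecting G (?V - {v}) (T i) \<and> eset (T i) \<subseteq> f i \<and> eset (T i) \<noteq> {}"
    by metis
  have disj: "eset (T i) \<inter> eset (T j) = {}" if "i < t" "j < t" "i \<noteq> j" for i j
    using T[OF that(1)] T[OF that(2)] f(2) that by blast
  have "inj_on T {..<t}"
  proof (rule inj_onI)
    fix i j assume ij: "i \<in> {..<t}" "j \<in> {..<t}" "T i = T j"
    then show "i = j"
      using disj[of i j] T[of j] by auto
  qed
  then have "card (T ` {..<t}) = t"
    by (simp add: card_image)
  moreover have "edge_disjoint_trees G (?V - {v}) (T ` {..<t})"
    unfolding edge_disjoint_trees_def pairwise_def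
  proof (intro conjI ballI impI)
    fix x y assume "x \<in> T ` {..<t}" "y \<in> T ` {..<t}" "x \<noteq> y"
    then show "eset x \<inter> eset y = {}"
      using disj by (elim imageE) (metis lessThan_iff)
  qed (use T in auto)
  ultimately show ?thesis
    using le_tree_conn[OF G] by metis
qed

text \<open>Every tree reaches \<open>u\<close> by an edge of its own.\<close>

lemma trees_le_deg:
  assumes G: "simple_ugraph G" and S: "u \<in> S" "S \<noteq> {u}" and T: "edge_disjoint_trees G S \<T>"
  shows "card \<T> \<le> deg (eset G) u"
proof -
  have "\<exists>e. e \<in> eset T \<and> u \<in> e" if "T \<in> \<T>" for T
  proof -
    have T': "connected_ugraph T" "S \<subseteq> vset T"
      using T that by (auto simp: edge_disjoint_trees_def tree_connecting_def tree_ugraph_def)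
    then have "{u} \<subseteq> vset T" "{u} \<noteq> {}" "{u} \<noteq> vset T"
      using S by auto
    with conn_if_connected_ugraph[OF T'(1)]
    obtain x y where "x \<in> {u}" "y \<in> vset T - {u}" "{x, y} \<in> eset T"
      by (rule connD) simp_all
    then show ?thesis
      by auto
  qed
  then obtain e where e: "\<And>T. T \<in> \<T> \<Longrightarrow> e T \<in> eset T \<and> u \<in> e T"
    by metis
  have "inj_on e \<T>"
  proof (rule inj_onI)
    fix T T' assume "T \<in> \<T>" "T' \<in> \<T>" "e T = e T'"
    moreover from this have "e T \<in> eset T \<inter> eset T'"
      using e[of T] e[of T'] by simp
    ultimately show "T = T'"
      using T unfolding edge_disjoint_trees_def pairwise_def by (metis empty_iff)
  qed
  moreover have "e ` \<T> \<subseteq> {x \<in> eset G. u \<in> x}"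
    using e edge_disjoint_trees_subset[OF T] by force
  moreover have "finite {x \<in> eset G. u \<in> x}"
    using finite_missing[of "vset G" "eset G"] G by (simp add: simple_ugraph_iff)
  ultimately show ?thesis
    unfolding deg_def by (rule card_inj_on_le)
qed

text \<open>A spanning tree has one edge more than a tree on \<open>V - {v}\<close>; so if the trees exhaust all
  edges, then no edge meets \<open>v\<close>.\<close>

lemma trees_edge_count:
  assumes G: "simple_ugraph G" and V: "card (vset G) = n + 2" "v \<in> vset G"
    and T: "edge_disjoint_trees G (vset G - {v}) \<T>"
  shows "card \<T> * n \<le> card (eset G)"
    and "card \<T> * n = card (eset G) \<Longrightarrow> e \<in> eset G \<Longrightarrow> v \<notin> e"
proof -
  have fin: "finite (vset G)" "finite (eset G)" "finite \<T>"
    using G finite_missing[of "vset G" "eset G"]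
      finite_subset[OF edge_disjoint_trees_subset[OF T] finite_subgraphs[OF G]]
    by (auto simp: simple_ugraph_iff)
  have sub: "eset T \<subseteq> eset G" "eset T \<subseteq> pairs (vset T)" "vset T = vset G \<or> vset T = vset G - {v}"
    "card (vset T) \<le> card (eset T) + 1" "finite (eset T)" if "T \<in> \<T>" for T
  proof -
    have T': "sub_ugraph T G" "connected_ugraph T" "vset G - {v} \<subseteq> vset T"
      using T that by (auto simp: edge_disjoint_trees_def tree_connecting_def tree_ugraph_def)
    then show *: "eset T \<subseteq> eset G" "eset T \<subseteq> pairs (vset T)" "vset T = vset G \<or> vset T = vset G - {v}"
      by (auto simp: sub_ugraph_def simple_ugraph_iff)
    show f: "finite (eset T)"
      using *(1) fin(2) by (rule finite_subset)
    show "card (vset T) \<le> card (eset T) + 1"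
      using T'(1) fin(1) f by (intro conn_card_le[OF conn_if_connected_ugraph[OF T'(2)]])
        (auto simp: sub_ugraph_def intro: finite_subset)
  qed
  have c: "n \<le> card (eset T)" "vset T = vset G \<Longrightarrow> n < card (eset T)" if "T \<in> \<T>" for T
  proof -
    have "card (vset G - {v}) = n + 1"
      using V fin(1) by simp
    then have "n + 1 \<le> card (vset T)"
      using sub(3)[OF that] V(1) by (elim disjE) simp_all
    then show "n \<le> card (eset T)"
      using sub(4)[OF that] by linarith
    show "n < card (eset T)" if "vset T = vset G"
      using sub(4)[OF \<open>T \<in> \<T>\<close>] V(1) that by simp
  qed
  have "(\<Sum>T\<in>\<T>. card (eset T)) = card (\<Union>T\<in>\<T>. eset T)"
    using fin(3) sub(5) T
    by (intro card_UN_disjoint[symmetric]) (auto simp: edge_disjoint_trees_def pairwise_def)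
  moreover have U: "(\<Union>T\<in>\<T>. eset T) \<subseteq> eset G"
    using sub(1) by blast
  then have "card (\<Union>T\<in>\<T>. eset T) \<le> card (eset G)"
    using fin(2) by (intro card_mono)
  moreover have "(\<Sum>T\<in>\<T>. n) \<le> (\<Sum>T\<in>\<T>. card (eset T))"
    using c(1) by (rule sum_mono)
  ultimately show "card \<T> * n \<le> card (eset G)"
    by simp
  assume eq: "card \<T> * n = card (eset G)" and e: "e \<in> eset G"
  have "card (\<Union>T\<in>\<T>. eset T) = card (eset G)"
    using \<open>(\<Sum>T\<in>\<T>. card (eset T)) = card (\<Union>T\<in>\<T>. eset T)\<close>
      \<open>card (\<Union>T\<in>\<T>. eset T) \<le> card (eset G)\<close> \<open>(\<Sum>T\<in>\<T>. n) \<le> (\<Sum>T\<in>\<T>. card (eset T))\<close> eq by simp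
  then have "(\<Union>T\<in>\<T>. eset T) = eset G"
    using card_subset_eq[OF fin(2) U] by blast
  then obtain T where T': "T \<in> \<T>" "e \<in> eset T"
    using e by blast
  have "vset T \<noteq> vset G"
  proof
    assume "vset T = vset G"
    then have "n < card (eset T)"
      using c(2)[OF T'(1)] by simp
    then have "(\<Sum>T\<in>\<T>. n) < (\<Sum>T\<in>\<T>. card (eset T))"
      using c(1) T'(1) fin(3) by (intro sum_strict_mono_ex1) auto
    then show False
      using eq \<open>(\<Sum>T\<in>\<T>. card (eset T)) = card (\<Union>T\<in>\<T>. eset T)\<close>
        \<open>card (\<Union>T\<in>\<T>. eset T) \<le> card (eset G)\<close> by simp
  qed
  then show "v \<notin> e"
    using sub(2,3)[OF T'(1)] T'(2) by (auto simp: pairs_def)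
qed

section \<open>Reduction to a witness graph and a packing statement\<close>

lemma extremal_edges_eqI:
  assumes "\<exists>G :: nat ugraph. simple_ugraph G \<and> card (vset G) = n \<and> max_tree_conn k G \<le> l \<and> card (eset G) = K"
    and "\<And>G :: nat ugraph. simple_ugraph G \<Longrightarrow> card (vset G) = n \<Longrightarrow> max_tree_conn k G \<le> l \<Longrightarrow>
      card (eset G) \<le> K"
  shows "extremal_edges n k l = K"
proof -
  let ?A = "{card (eset G) | G :: nat ugraph.
            simple_ugraph G \<and> card (vset G) = n \<and> max_tree_conn k G \<le> l}"
  have "?A \<subseteq> {..K}"
    using assms(2) by blast
  then have "finite ?A"
    by (rule finite_subset) simp
  then show ?thesis
    unfolding extremal_edges_def using assms by (intro Max_eqI) auto
qed

lemma edges_le_if_spack: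
  fixes G :: "'a ugraph"
  assumes G: "simple_ugraph G" "card (vset G) = n" "3 \<le> n" "max_tree_conn (n - 1) G \<le> l"
    and pack: "\<And>M. M \<subseteq> pairs (vset G) \<Longrightarrow> card M + K < n choose 2 \<Longrightarrow>
      \<exists>v\<in>vset G. spack (Suc l) (vset G) v (pairs (vset G) - M)"
  shows "card (eset G) \<le> K"
proof (rule ccontr)
  assume *: "\<not> card (eset G) \<le> K"
  let ?M = "pairs (vset G) - eset G"
  have fin: "finite (vset G)" and E: "eset G \<subseteq> pairs (vset G)"
    using G(1) by (auto simp: simple_ugraph_iff)
  have "card ?M + card (eset G) = n choose 2"
    using E finite_pairs[OF fin] card_pairs[OF fin] G(2) card_mono[OF finite_pairs[OF fin] E]
    by (simp add: card_Diff_subset finite_subset)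
  then obtain v where v: "v \<in> vset G" "spack (Suc l) (vset G) v (pairs (vset G) - ?M)"
    using pack[of ?M] * by auto
  have "pairs (vset G) - ?M = eset G"
    using E by blast
  then have "Suc l \<le> tree_conn G (vset G - {v})"
    using v G by (intro spack_imp_tree_conn) auto
  also have "\<dots> \<le> max_tree_conn (n - 1) G"
    using tree_conn_le_max[OF G(1), of "vset G - {v}"] v(1) G(2) fin by auto
  finally show False
    using G(4) by simp
qed

section \<open>The extremal number\<close>

lemma Suc_choose_two: "Suc n choose 2 = (n choose 2) + n"
  by (simp add: numeral_2_eq_2)

lemma even_choose_two: "2 * n choose 2 = n * (2 * n - 1)"
  by (simp add: choose_two)

lemma odd_choose_two: "Suc (2 * n) choose 2 = n * (2 * n + 1)"
  by (simp add: choose_two)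

text \<open>For the smaller values of \<open>l\<close>: two vertices of degree \<open>l\<close>, attached to a complete graph,
  one of which belongs to every set of \<open>n + 1\<close> vertices.\<close>

lemma graph_two_low_vertices:
  fixes n l :: nat
  assumes "l \<le> n" "1 \<le> n"
  shows "\<exists>G :: nat ugraph. simple_ugraph G \<and> card (vset G) = n + 2 \<and>
    max_tree_conn (n + 1) G \<le> l \<and> card (eset G) = (n choose 2) + 2 * l"
proof -
  let ?E = "pairs {..<n} \<union> (star n {..<l} \<union> star (Suc n) {..<l})"
  let ?G = "({..<n + 2}, ?E)"
  have G: "simple_ugraph ?G"
    using assms(1) pairs_mono[of "{..<n}" "{..<n + 2}"]
    by (auto simp: simple_ugraph_iff star_def doubleton_in_pairs)
  have card_star: "card (star a {..<l}) = l" for a :: nat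
    unfolding star_def by (subst card_image) (auto simp: inj_on_def doubleton_eq_iff)
  have "card (star n {..<l} \<union> star (Suc n) {..<l}) = l + l"
    using assms(1) by (subst card_Un_disjoint) (auto simp: star_def doubleton_eq_iff card_star[unfolded star_def])
  moreover have "pairs {..<n} \<inter> (star n {..<l} \<union> star (Suc n) {..<l}) = {}"
    by (auto simp: star_def pairs_def)
  ultimately have cE: "card ?E = (n choose 2) + 2 * l"
    by (subst card_Un_disjoint) (auto simp: finite_pairs card_pairs star_def)
  have deg_l: "deg ?E u = l" if "u = n \<or> u = Suc n" for u
  proof -
    have "{e \<in> ?E. u \<in> e} = star u {..<l}"
      using that assms(1) by (auto simp: star_def pairs_def)
    then show ?thesis
      by (simp add: deg_def card_star)
  qed
  have "max_tree_conn (n + 1) ?G \<le> l"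
  proof (rule max_tree_conn_le[OF G])
    fix v \<T> assume T: "edge_disjoint_trees ?G (vset ?G - {v}) \<T>"
    define u where "u = (if v = n then Suc n else n)"
    have u: "u = n \<or> u = Suc n" "u \<noteq> v"
      by (auto simp: u_def)
    obtain x where "x \<in> {..<n + 2} - {v}" "x \<noteq> u"
    proof -
      have "\<not> {..<n + 2} \<subseteq> {u, v}"
      proof
        assume "{..<n + 2} \<subseteq> {u, v}"
        then have "card {..<n + 2} \<le> card {u, v}"
          by (intro card_mono) auto
        then show False
          using u assms(2) by simp
      qed
      then show ?thesis
        using that by blast
    qed
    then have "card \<T> \<le> deg (eset ?G) u"
      using u by (intro trees_le_deg[OF G _ _ T]) auto
    then show "card \<T> \<le> l"
      using deg_l[OF u(1)] by simp
  qed simp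
  then show ?thesis
    using G cE by (intro exI[of _ ?G]) simp
qed

text \<open>A spanning star inside \<open>E\<close> ensures that every vertex lies on an edge.
  \<open>Suc l\<close> trees would need at least \<open>Suc l * n \<ge> K\<close> edges, hence all
  of \<open>E\<close>, and then by \<open>trees_edge_count\<close> no edge could meet
  \<open>v\<close>.\<close>

lemma graph_by_edge_count:
  fixes n l K :: nat
  assumes K: "n + 1 \<le> K" "K \<le> n + 2 choose 2"
    and count: "K \<le> Suc l * n"
  shows "\<exists>G :: nat ugraph. simple_ugraph G \<and> card (vset G) = n + 2 \<and>
    max_tree_conn (n + 1) G \<le> l \<and> card (eset G) = K"
proof -
  let ?V = "{..<n + 2}"
  let ?S = "star 0 {1..n + 1}"
  have "card ?S = n + 1"
    unfolding star_def by (subst card_image) (auto simp: inj_on_def doubleton_eq_iff)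
  moreover have "?S \<subseteq> pairs ?V"
    by (auto simp: star_def doubleton_in_pairs)
  ultimately obtain E where E: "?S \<subseteq> E" "E \<subseteq> pairs ?V" "card E = K"
    using exists_subset_between[of ?S K "pairs ?V"] K by (auto simp: card_pairs finite_pairs)
  have G: "simple_ugraph (?V, E)"
    using E(2) by (simp add: simple_ugraph_iff)
  have "max_tree_conn (n + 1) (?V, E) \<le> l"
  proof (rule max_tree_conn_le[OF G])
    fix v \<T> assume v: "v \<in> vset (?V, E)" and T: "edge_disjoint_trees (?V, E) (vset (?V, E) - {v}) \<T>"
    note tc = trees_edge_count[OF G _ v T, of n]
    show "card \<T> \<le> l"
    proof (rule ccontr)
      assume "\<not> card \<T> \<le> l"
      then have "Suc l * n \<le> card \<T> * n"
        by (intro mult_right_mono) auto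
      then have "card \<T> * n = card E"
        using count tc(1) E(3) by simp
      moreover have "{0, if v = 0 then 1 else v} \<in> E"
        using E(1) v by (auto simp: star_def)
      ultimately show False
        using tc(2) by (auto split: if_splits)
    qed
  qed simp
  then show ?thesis
    using G E(3) by (intro exI[of _ "(?V, E)"]) simp
qed

theorem corollary4:
  fixes n l :: nat
  assumes "n \<ge> 12" and "1 \<le> l" and "l \<le> (n + 1) div 2"
  shows
    "(l \<le> (n - 5) div 2 \<or> (l = (n - 3) div 2 \<and> even n)
        \<longrightarrow> extremal_edges n (n - 1) l = ((n - 2) choose 2) + 2 * l) \<and>
     (l = (n - 3) div 2 \<and> odd n
        \<longrightarrow> extremal_edges n (n - 1) l = ((n - 2) choose 2) + 2 * l + 1) \<and>
     (l = (n - 1) div 2 \<and> even n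
        \<longrightarrow> extremal_edges n (n - 1) l = ((n - 1) choose 2) + l) \<and>
     (l = (n - 1) div 2 \<and> odd n
        \<longrightarrow> extremal_edges n (n - 1) l = ((n - 1) choose 2) + 2 * l - 1) \<and>
     (l = (n + 1) div 2
        \<longrightarrow> extremal_edges n (n - 1) l = n choose 2)"
proof -
  obtain m where m: "n = m + 2"
    using assms(1) by (intro that[of "n - 2"]) simp
  have ch: "n choose 2 = (m choose 2) + 2 * m + 1" "n - 1 choose 2 = (m choose 2) + m"
    using Suc_choose_two[of m] Suc_choose_two[of "Suc m"] by (simp_all add: m)
  have eqI: "extremal_edges n (n - 1) l = K"
    if ex: "\<exists>G :: nat ugraph. simple_ugraph G \<and> card (vset G) = m + 2 \<and>
          max_tree_conn (m + 1) G \<le> l \<and> card (eset G) = K"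
      and pack: "\<And>(V :: nat set) M. finite V \<Longrightarrow> card V = n \<Longrightarrow> M \<subseteq> pairs V \<Longrightarrow>
          card M + K < n choose 2 \<Longrightarrow> \<exists>v\<in>V. spack (Suc l) V v (pairs V - M)"
    for K
  proof (rule extremal_edges_eqI)
    show "card (eset G) \<le> K"
      if G: "simple_ugraph G" "card (vset G) = n" "max_tree_conn (n - 1) G \<le> l" for G :: "nat ugraph"
    proof (rule edges_le_if_spack[OF G(1,2) _ G(3)])
      have "finite (vset G)"
        using G(1) by (simp add: simple_ugraph_def)
      then show "\<exists>v\<in>vset G. spack (Suc l) (vset G) v (pairs (vset G) - M)"
        if "M \<subseteq> pairs (vset G)" "card M + K < n choose 2" for M
        using pack G(2) that by simp
    qed (use assms(1) in simp)
  qed (use ex in \<open>simp add: m\<close>)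
  have c1: "extremal_edges n (n - 1) l = ((n - 2) choose 2) + 2 * l"
    if l: "l \<le> (n - 5) div 2 \<or> (l = (n - 3) div 2 \<and> even n)"
  proof (rule eqI)
    \<comment> \<open>In both ranges the complement satisfies
      \<open>card M \<le> 2 * (n - 2 - l)\<close>, the size of two stars; only the number of
      vertices left after a deletion differs.\<close>
    have "2 * l + 5 \<le> n \<or> n = 2 * l + 4"
      using l assms(1) by auto
    then show "\<exists>v\<in>V. spack (Suc l) V v (pairs V - M)"
      if V: "finite V" "card V = n" "M \<subseteq> pairs V" "card M + (((n - 2) choose 2) + 2 * l) < n choose 2"
      for V :: "nat set" and M
    proof
      assume "2 * l + 5 \<le> n"
      then obtain v where "v \<in> V" "spack (Suc l) V v (pairs V - M)"
        using spack_large[OF V(1,3) assms(2)] V(2,4) ch by (auto simp: m)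
      then show ?thesis
        by blast
    next
      assume "n = 2 * l + 4"
      then obtain v where "v \<in> V" "spack (Suc l) V v (pairs V - M)"
        using spack_tight_even[OF V(1,3), of l] V(2,4) ch assms(1) by (auto simp: m)
      then show ?thesis
        by blast
    qed
    show "\<exists>G :: nat ugraph. simple_ugraph G \<and> card (vset G) = m + 2 \<and>
        max_tree_conn (m + 1) G \<le> l \<and> card (eset G) = ((n - 2) choose 2) + 2 * l"
      using graph_two_low_vertices[of l m] l assms(1) by (auto simp: m)
  qed
  have c2: "extremal_edges n (n - 1) l = ((n - 2) choose 2) + 2 * l + 1"
    if l: "l = (n - 3) div 2" "odd n"
  proof (rule eqI)
    have n: "n = 2 * l + 3"
      using l assms(1) by presburger
    show "\<exists>v\<in>V. spack (Suc l) V v (pairs V - M)"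
      if V: "finite V" "card V = n" "M \<subseteq> pairs V" "card M + (((n - 2) choose 2) + 2 * l + 1) < n choose 2"
      for V :: "nat set" and M
    proof -
      obtain v where "v \<in> V" "spack (Suc l) V v (pairs V - M)"
        using spack_odd[OF V(1,3), of l] V(2,4) ch n by (auto simp: m)
      then show ?thesis
        by blast
    qed
    \<comment> \<open>From here on the extremal value is the counting bound
      \<open>Suc l * m\<close>, in this case and the next two.\<close>
    have K: "((n - 2) choose 2) + 2 * l + 1 = Suc l * m" "m = 2 * l + 1"
      using n odd_choose_two[of l] by (simp_all add: m algebra_simps)
    show "\<exists>G :: nat ugraph. simple_ugraph G \<and> card (vset G) = m + 2 \<and>
        max_tree_conn (m + 1) G \<le> l \<and> card (eset G) = ((n - 2) choose 2) + 2 * l + 1"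
    proof (rule graph_by_edge_count)
      show "m + 1 \<le> ((n - 2) choose 2) + 2 * l + 1"
        using K assms(2) by (simp add: algebra_simps)
      show "((n - 2) choose 2) + 2 * l + 1 \<le> m + 2 choose 2"
        using ch(1) K(2) by (simp add: m)
    qed (use K in simp)
  qed
  have c3: "extremal_edges n (n - 1) l = ((n - 1) choose 2) + l"
    if l: "l = (n - 1) div 2" "even n"
  proof (rule eqI)
    have n: "n = 2 * l + 2"
      using l assms(1) by presburger
    show "\<exists>v\<in>V. spack (Suc l) V v (pairs V - M)"
      if V: "finite V" "card V = n" "M \<subseteq> pairs V" "card M + (((n - 1) choose 2) + l) < n choose 2"
      for V :: "nat set" and M
    proof -
      obtain v where "v \<in> V" "spack (Suc l) V v (pairs V - M)"
        using spack_even[OF V(1,3), of l] V(2,4) ch n by (auto simp: m)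
      then show ?thesis
        by blast
    qed
    have K: "((n - 1) choose 2) + l = Suc l * m" "m = 2 * l"
      using n odd_choose_two[of l] by (simp_all add: m algebra_simps)
    show "\<exists>G :: nat ugraph. simple_ugraph G \<and> card (vset G) = m + 2 \<and>
        max_tree_conn (m + 1) G \<le> l \<and> card (eset G) = ((n - 1) choose 2) + l"
    proof (rule graph_by_edge_count)
      show "m + 1 \<le> ((n - 1) choose 2) + l"
        using K assms by (simp add: algebra_simps)
      show "((n - 1) choose 2) + l \<le> m + 2 choose 2"
        using ch K(2) by (simp add: m)
    qed (use K in simp)
  qed
  have c4: "extremal_edges n (n - 1) l = ((n - 1) choose 2) + 2 * l - 1"
    if l: "l = (n - 1) div 2" "odd n"
  proof (rule eqI)
    have n: "n = 2 * l + 1"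
      using l assms(1) by presburger
    have m': "m + 1 = 2 * l"
      using n m by simp
    show "\<exists>v\<in>V. spack (Suc l) V v (pairs V - M)"
      if V: "finite V" "card V = n" "M \<subseteq> pairs V" "card M + (((n - 1) choose 2) + 2 * l - 1) < n choose 2"
      for V :: "nat set" and M
    proof -
      have "card M = 0"
        using V(4) ch m' by linarith
      then have "M = {}"
        using finite_missing[OF V(1,3)] by simp
      moreover obtain v where "v \<in> V"
        using V(2) assms(1) by fastforce
      ultimately show ?thesis
        using spack_complete[OF V(1), of l v] V(2) n by auto
    qed
    have K: "((n - 1) choose 2) + 2 * l - 1 = Suc l * m"
    proof -
      have "n - 1 choose 2 = l * m"
        using even_choose_two[of l] m' n by (metis add_diff_cancel_right')
      then show ?thesis
        using m' by simp
    qed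
    show "\<exists>G :: nat ugraph. simple_ugraph G \<and> card (vset G) = m + 2 \<and>
        max_tree_conn (m + 1) G \<le> l \<and> card (eset G) = ((n - 1) choose 2) + 2 * l - 1"
    proof (rule graph_by_edge_count)
      have "2 * m \<le> Suc l * m"
        using assms(2) by (intro mult_right_mono) auto
      then show "m + 1 \<le> ((n - 1) choose 2) + 2 * l - 1"
        using K m assms(1) by linarith
      show "((n - 1) choose 2) + 2 * l - 1 \<le> m + 2 choose 2"
        using ch m' by (simp add: m)
    qed (use K in simp)
  qed
  have c5: "extremal_edges n (n - 1) l = n choose 2" if l: "l = (n + 1) div 2"
  proof (rule eqI)
    have "m + 3 \<le> 2 * l + 1"
      using l m by presburger
    then have l2: "m + 2 \<le> 2 * l"
      by simp
    show "\<exists>G :: nat ugraph. simple_ugraph G \<and> card (vset G) = m + 2 \<and>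
        max_tree_conn (m + 1) G \<le> l \<and> card (eset G) = n choose 2"
    proof (rule graph_by_edge_count)
      \<comment> \<open>As \<open>2 * Suc l \<ge> m + 4\<close>, even the complete graph has fewer
        than \<open>Suc l * m\<close> edges.\<close>
      have "2 * (n choose 2) = (m + 2) * (m + 1)"
        by (simp add: choose_two m)
      moreover have "(m + 4) * m \<le> (2 * Suc l) * m"
        using l2 by (intro mult_right_mono) auto
      moreover have "(m + 2) * (m + 1) < (m + 4) * m"
        using m assms(1) by (simp add: algebra_simps)
      ultimately show "n choose 2 \<le> Suc l * m"
        by simp
    qed (use ch m assms(1) in simp_all)
  qed simp
  show ?thesis
    using c1 c2 c3 c4 c5 by blast
qed

end
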